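(* Fix $\epsilon\in(0,1]$ and suppose $B\ge C\frac{m^2}{\epsilon^3}\log\frac{m}{\epsilon}$ for a sufficiently large absolute constant $C$. Then algorithm Robust OTP returns a solution to the online packing LP with expected value at least $(1-10\epsilon)\,\mathrm{OPT}$.
   Context: Online packing LP: positive integers $m,n$, $B>0$, rewards $\pi_1,\dots,\pi_n\ge0$, columns $a^1,\dots,a^n\in[0,1]^m\setminus\{0\}$; the LP maximizes $\sum_t\pi_tx_t$ subject to $\sum_ta^t_ix_t\le B$ ($i\in[m]$), $x\in[0,1]^n$, with optimal value $\mathrm{OPT}$. General position: for every $p\in\mathbb{R}^m$ at most $m$ indices $t$ satisfy $\pi_t=p\cdot a^t$. Columns arrive in uniformly random order $\sigma(1),\dots,\sigma(n)$, $n$ known, variables set irrevocably on arrival. Assume $\epsilon n$ and $(m+1)/\epsilon$ are integers. For $p\in\mathbb{R}^m$, $x(p)_t=1$ iff $\pi_t>p\cdot a^t$. Algorithm OTP on an LP with columns $(\pi_t,\hat a^t)$ and right-hand side $\hat B$: wait for the first $\epsilon n$ columns (set to $0$), compute an optimal solution $(p,\alpha)$ of the dual LP: minimize $\epsilon(1-\epsilon)\hat B\sum_ip_i+\sum_{t\le\epsilon n}\alpha_{\sigma(t)}$ s.t. $p\cdot\hat a^{\sigma(t)}+\alpha_{\sigma(t)}\ge\pi_{\sigma(t)}$ ($t\le\epsilon n$), $p,\alpha\ge0$; then for $t=\epsilon n+1,\dots$ set $x_{\sigma(t)}=x(p)_{\sigma(t)}$ (computed with the $\hat a^t$) as long as the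 solution remains feasible for that LP, and set all later variables to $0$. Robust OTP: let $\delta=\frac{\epsilon}{m+1}$ and $Q$ the set of vectors in $\{0,\delta,2\delta,\dots,1\}^m$ with $\ell_\infty$-norm $1$; replace each $a^t$ by $\tilde a^t=\|a^t\|_\infty q^t$, where $q^t\in Q$ is an $\ell_\infty$-closest vector in $Q$ to $a^t/\|a^t\|_\infty$; return the solution of OTP run on the LP with columns $(\pi_t,\tilde a^t)$ and right-hand side $(1-\epsilon)B$.
   Formalization: General position is assumed also for the rounded columns ã^t on which OTP is run, not only for the a^t; without this the claim fails, e.g. when all rounded columns satisfy π_t = p·ã^t for one p and the algorithm returns 0. *)

theory Defs
  imports "HOL-Probability.Probability" "HOL-Combinatorics.Permutations"
begin

text \<open>
  Vectors of \<open>\<real>\<^sup>m\<close> are functions \<open>nat \<Rightarrow> real\<close> of which only the coordinates \<open>i < m\<close> are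
  ever inspected; \<open>a t i\<close> is the \<open>i\<close>-th entry of column \<open>t\<close>, for \<open>t < n\<close> and \<open>i < m\<close>.
  All indices start at 0.
\<close>

definition dot :: "nat \<Rightarrow> (nat \<Rightarrow> real) \<Rightarrow> (nat \<Rightarrow> real) \<Rightarrow> real" where
  "dot m u v = (\<Sum>i<m. u i * v i)"

definition linf :: "nat \<Rightarrow> (nat \<Rightarrow> real) \<Rightarrow> real" where
  "linf m v = Max ((\<lambda>i. \<bar>v i\<bar>) ` {..<m})"

definition lp_value :: "nat \<Rightarrow> (nat \<Rightarrow> real) \<Rightarrow> (nat \<Rightarrow> real) \<Rightarrow> real" where
  "lp_value n \<pi> x = (\<Sum>t<n. \<pi> t * x t)"

definition lp_feasible ::
  "nat \<Rightarrow> nat \<Rightarrow> real \<Rightarrow> (nat \<Rightarrow> nat \<Rightarrow> real) \<Rightarrow> (nat \<Rightarrow> real) \<Rightarrow> bool" where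
  "lp_feasible m n B a x \<longleftrightarrow>
     (\<forall>t<n. 0 \<le> x t \<and> x t \<le> 1) \<and> (\<forall>i<m. (\<Sum>t<n. a t i * x t) \<le> B)"

definition lp_opt ::
  "nat \<Rightarrow> nat \<Rightarrow> real \<Rightarrow> (nat \<Rightarrow> real) \<Rightarrow> (nat \<Rightarrow> nat \<Rightarrow> real) \<Rightarrow> real" where
  "lp_opt m n B \<pi> a = (SUP x\<in>{x. lp_feasible m n B a x}. lp_value n \<pi> x)"

definition packing_lp ::
  "nat \<Rightarrow> nat \<Rightarrow> real \<Rightarrow> (nat \<Rightarrow> real) \<Rightarrow> (nat \<Rightarrow> nat \<Rightarrow> real) \<Rightarrow> bool" where
  "packing_lp m n B \<pi> a \<longleftrightarrow>
     0 < m \<and> 0 < n \<and> 0 < B \<and> (\<forall>t<n. 0 \<le> \<pi> t) \<and>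
     (\<forall>t<n. (\<forall>i<m. 0 \<le> a t i \<and> a t i \<le> 1) \<and> (\<exists>i<m. a t i \<noteq> 0))"

definition general_position ::
  "nat \<Rightarrow> nat \<Rightarrow> (nat \<Rightarrow> real) \<Rightarrow> (nat \<Rightarrow> nat \<Rightarrow> real) \<Rightarrow> bool" where
  "general_position m n \<pi> a \<longleftrightarrow>
     (\<forall>p :: nat \<Rightarrow> real. card {t. t < n \<and> \<pi> t = dot m p (a t)} \<le> m)"

definition price_sol ::
  "nat \<Rightarrow> (nat \<Rightarrow> real) \<Rightarrow> (nat \<Rightarrow> nat \<Rightarrow> real) \<Rightarrow> (nat \<Rightarrow> real) \<Rightarrow> nat \<Rightarrow> real" where
  "price_sol m \<pi> a p t = (if \<pi> t > dot m p (a t) then 1 else 0)"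

text \<open>The dual of the sampled LP. \<open>ts\<close> lists the indices of the sampled columns in order of
  arrival, and \<open>\<alpha>\<close> is indexed by columns rather than by arrival times.\<close>

definition dual_feasible ::
  "nat \<Rightarrow> (nat \<Rightarrow> real) \<Rightarrow> (nat \<Rightarrow> nat \<Rightarrow> real) \<Rightarrow> nat list
     \<Rightarrow> (nat \<Rightarrow> real) \<times> (nat \<Rightarrow> real) \<Rightarrow> bool" where
  "dual_feasible m \<pi> a ts = (\<lambda>(p, \<alpha>).
     (\<forall>i<m. 0 \<le> p i) \<and> (\<forall>t\<in>set ts. 0 \<le> \<alpha> t \<and> dot m p (a t) + \<alpha> t \<ge> \<pi> t))"

definition dual_objective ::
  "nat \<Rightarrow> real \<Rightarrow> real \<Rightarrow> nat list \<Rightarrow> (nat \<Rightarrow> real) \<times> (nat \<Rightarrow> real) \<Rightarrow> real" where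
  "dual_objective m B \<epsilon> ts = (\<lambda>(p, \<alpha>).
     \<epsilon> * (1 - \<epsilon>) * B * (\<Sum>i<m. p i) + (\<Sum>t\<in>set ts. \<alpha> t))"

definition dual_optimal ::
  "nat \<Rightarrow> real \<Rightarrow> (nat \<Rightarrow> real) \<Rightarrow> (nat \<Rightarrow> nat \<Rightarrow> real) \<Rightarrow> real \<Rightarrow> nat list
     \<Rightarrow> (nat \<Rightarrow> real) \<times> (nat \<Rightarrow> real) \<Rightarrow> bool" where
  "dual_optimal m B \<pi> a \<epsilon> ts =
     is_arg_min (dual_objective m B \<epsilon> ts) (dual_feasible m \<pi> a ts)"

text \<open>An arrival order is a permutation \<open>\<sigma>\<close> of \<open>{..<n}\<close>: column \<open>\<sigma> k\<close> arrives at time \<open>k\<close>.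
  The sample size \<open>\<epsilon> n\<close> is assumed to be an integer wherever it is used.\<close>

definition sample_size :: "real \<Rightarrow> nat \<Rightarrow> nat" where
  "sample_size \<epsilon> n = nat \<lfloor>\<epsilon> * real n\<rfloor>"

definition sampled :: "real \<Rightarrow> nat \<Rightarrow> (nat \<Rightarrow> nat) \<Rightarrow> nat list" where
  "sampled \<epsilon> n \<sigma> = map \<sigma> [0..<sample_size \<epsilon> n]"

text \<open>Optimal dual solutions need not be unique. A concrete implementation of the algorithm is
  given by a rule \<open>sel\<close> that maps the columns sampled so far to an optimal dual solution.\<close>

definition dual_rule ::
  "nat \<Rightarrow> nat \<Rightarrow> real \<Rightarrow> (nat \<Rightarrow> real) \<Rightarrow> (nat \<Rightarrow> nat \<Rightarrow> real) \<Rightarrow> real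
     \<Rightarrow> (nat list \<Rightarrow> (nat \<Rightarrow> real) \<times> (nat \<Rightarrow> real)) \<Rightarrow> bool" where
  "dual_rule m n B \<pi> a \<epsilon> sel \<longleftrightarrow>
     (\<forall>\<sigma>. \<sigma> permutes {..<n} \<longrightarrow>
        dual_optimal m B \<pi> a \<epsilon> (sampled \<epsilon> n \<sigma>) (sel (sampled \<epsilon> n \<sigma>)))"

text \<open>Follow the proposed solution \<open>y\<close> as long as feasibility is kept; the flag becomes \<open>False\<close>
  at the first violation, after which every variable keeps its initial value 0.\<close>

definition otp_step ::
  "nat \<Rightarrow> nat \<Rightarrow> real \<Rightarrow> (nat \<Rightarrow> nat \<Rightarrow> real) \<Rightarrow> (nat \<Rightarrow> real)
     \<Rightarrow> (nat \<Rightarrow> real) \<times> bool \<Rightarrow> nat \<Rightarrow> (nat \<Rightarrow> real) \<times> bool" where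
  "otp_step m n B a y = (\<lambda>(x, active) t.
     if active \<and> lp_feasible m n B a (x(t := y t)) then (x(t := y t), True) else (x, False))"

definition otp ::
  "nat \<Rightarrow> nat \<Rightarrow> real \<Rightarrow> (nat \<Rightarrow> real) \<Rightarrow> (nat \<Rightarrow> nat \<Rightarrow> real) \<Rightarrow> real
     \<Rightarrow> (nat list \<Rightarrow> (nat \<Rightarrow> real) \<times> (nat \<Rightarrow> real)) \<Rightarrow> (nat \<Rightarrow> nat) \<Rightarrow> (nat \<Rightarrow> real)" where
  "otp m n B \<pi> a \<epsilon> sel \<sigma> =
     (let p = fst (sel (sampled \<epsilon> n \<sigma>))
      in fst (foldl (otp_step m n B a (price_sol m \<pi> a p)) (\<lambda>_. 0, True)
                (map \<sigma> [sample_size \<epsilon> n..<n])))"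

definition grid :: "nat \<Rightarrow> real \<Rightarrow> (nat \<Rightarrow> real) set" where
  "grid m \<epsilon> = (let \<delta> = \<epsilon> / (real m + 1) in
     {q. (\<forall>i<m. \<exists>k::nat. real k * \<delta> \<le> 1 \<and> q i = real k * \<delta>) \<and> linf m q = 1})"

definition closest_directions ::
  "nat \<Rightarrow> nat \<Rightarrow> (nat \<Rightarrow> nat \<Rightarrow> real) \<Rightarrow> real \<Rightarrow> (nat \<Rightarrow> nat \<Rightarrow> real) \<Rightarrow> bool" where
  "closest_directions m n a \<epsilon> q \<longleftrightarrow>
     (\<forall>t<n. is_arg_min (\<lambda>v. linf m (\<lambda>i. a t i / linf m (a t) - v i))
              (\<lambda>v. v \<in> grid m \<epsilon>) (q t))"

definition rounded ::
  "nat \<Rightarrow> (nat \<Rightarrow> nat \<Rightarrow> real) \<Rightarrow> (nat \<Rightarrow> nat \<Rightarrow> real) \<Rightarrow> nat \<Rightarrow> nat \<Rightarrow> real" where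
  "rounded m a q t i = linf m (a t) * q t i"

definition robust_otp ::
  "nat \<Rightarrow> nat \<Rightarrow> real \<Rightarrow> (nat \<Rightarrow> real) \<Rightarrow> (nat \<Rightarrow> nat \<Rightarrow> real) \<Rightarrow> real \<Rightarrow> (nat \<Rightarrow> nat \<Rightarrow> real)
     \<Rightarrow> (nat list \<Rightarrow> (nat \<Rightarrow> real) \<times> (nat \<Rightarrow> real)) \<Rightarrow> (nat \<Rightarrow> nat) \<Rightarrow> (nat \<Rightarrow> real)" where
  "robust_otp m n B \<pi> a \<epsilon> q sel \<sigma> = otp m n ((1 - \<epsilon>) * B) \<pi> (rounded m a q) \<epsilon> sel \<sigma>"

definition random_order :: "nat \<Rightarrow> (nat \<Rightarrow> nat) pmf" where
  "random_order n = pmf_of_set {\<sigma>. \<sigma> permutes {..<n}}"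

end

(*
  After rounding, the columns point in few directions d. For a price vector p the chosen set is,
  within each direction, an upper level set of the ratio of reward to weight, so these parts are
  nested as p varies. Recording which multiples of B / N the chosen weight of each direction
  exceeds (the level of p) amounts to a sign pattern of affine functions of p, so there are only
  polynomially many levels in the number K of directions for fixed m. Within one level the loads
  of the chosen sets differ by at most K B / N, so that each of them is squeezed between two sets
  (lower and upper) that depend on the level only. A Chernoff bound for sampling without
  replacement and a union bound over the levels then show that, except with probability at most
  epsilon, the sampled load predicts the true load for all price vectors at once.

  Perturbing one coordinate of an optimal dual solution shows that the sampled load of its chosen
  set is at most epsilon (1 - epsilon) B, and at least this minus m in rows of positive price; the
  m accounts for the ties allowed by general position. Hence, for a good sample, the price solution
  is feasible and nearly tight in rows of positive price, and weak duality makes it nearly optimal.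
  The sample itself costs at most epsilon OPT, since the averaged sample solution divided by epsilon
  is feasible. For epsilon >= 1/10 there is nothing to show.
*)
theory Submission
  imports Defs
begin

section \<open>Counting cells of an affine arrangement by deletion and restriction\<close>

section \<open>Sign patterns of affine functions\<close>

text \<open>Adding a function \<open>f\<close> splits in two only those patterns that occur on both
  sides of the hyperplane \<open>f = 0\<close>. Such patterns also occur on the hyperplane itself,
  where one variable can be eliminated. With k old functions and d variables this gives (k+1)^d +
  (k+1)^(d-1) = (k+2) (k+1)^(d-1), which is at most (k+2)^d.\<close>

lemma card_affine_patterns:
  fixes c :: "'j \<Rightarrow> 'i \<Rightarrow> real" and b :: "'j \<Rightarrow> real"
  assumes "finite J" "finite I"
  shows "card (range (\<lambda>p. {j\<in>J. 0 < (\<Sum>i\<in>I. p i * c j i) + b j})) \<le> (card J + 1) ^ card I"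
  using assms
proof (induction J arbitrary: I c b rule: finite_induct)
  case empty
  then show ?case by simp
next
  case (insert f J)
  define g where "g = (\<lambda>(c :: 'j \<Rightarrow> 'i \<Rightarrow> real) (b :: 'j \<Rightarrow> real) I j p. (\<Sum>i\<in>I. p i * c j i) + b j)"
  define pat where "pat = (\<lambda>c b I (J::'j set). range (\<lambda>p. {j\<in>J. 0 < g c b I j p}))"
  have IH: "card (pat c b I J) \<le> (card J + 1) ^ card I" if "finite I" for I c b
    using insert.IH[OF that] unfolding pat_def g_def .
  have fin: "finite (pat c b I J)" for c b I
    by (rule finite_subset[of _ "Pow J"]) (auto simp: pat_def insert.hyps)
  let ?P = "pat c b I (insert f J)"
  have finP: "finite ?P"
    by (rule finite_subset[of _ "Pow (insert f J)"]) (auto simp: pat_def insert.hyps)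
  define P0 where "P0 = {X \<in> ?P. f \<notin> X}"
  define P1 where "P1 = {X \<in> ?P. f \<in> X}"
  define Q1 where "Q1 = (\<lambda>X. X - {f}) ` P1"
  have fins: "finite P0" "finite P1" "finite Q1"
    using finP by (auto simp: P0_def P1_def Q1_def)
  have P0D: "\<exists>p. X = {j\<in>J. 0 < g c b I j p} \<and> g c b I f p \<le> 0" if X: "X \<in> P0" for X
  proof -
    obtain p where "X = {j\<in>insert f J. 0 < g c b I j p}" "f \<notin> X"
      using X unfolding P0_def pat_def by blast
    then show ?thesis by (intro exI[of _ p]) (auto simp: not_less)
  qed
  have Q1D: "\<exists>p. X = {j\<in>J. 0 < g c b I j p} \<and> 0 < g c b I f p" if X: "X \<in> Q1" for X
  proof -
    obtain Y where Y: "Y \<in> P1" "X = Y - {f}" using X by (auto simp: Q1_def)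
    then obtain p where "Y = {j\<in>insert f J. 0 < g c b I j p}" "f \<in> Y"
      unfolding P1_def pat_def by blast
    then show ?thesis using Y(2) insert.hyps(2) by (intro exI[of _ p]) auto
  qed
  have "inj_on (\<lambda>X. X - {f}) P1" by (rule inj_onI) (metis (no_types, lifting) P1_def insert_Diff mem_Collect_eq)
  then have cQ1: "card Q1 = card P1" unfolding Q1_def by (rule card_image)
  have "?P = P0 \<union> P1" "P0 \<inter> P1 = {}" by (auto simp: P0_def P1_def)
  then have "card ?P = card P0 + card Q1" using fins by (simp add: card_Un_disjoint cQ1)
  \<comment> \<open>The union consists of patterns on \<open>J\<close> alone; the intersection
    counts those that \<open>f\<close> splits.\<close>
  also have "\<dots> = card (P0 \<union> Q1) + card (P0 \<inter> Q1)" by (rule card_Un_Int[OF fins(1,3)])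
  also have "\<dots> \<le> (card J + 1) ^ card I + card (P0 \<inter> Q1)"
  proof (rule add_right_mono)
    have "card (P0 \<union> Q1) \<le> card (pat c b I J)"
    proof (rule card_mono[OF fin], rule subsetI)
      fix X assume "X \<in> P0 \<union> Q1"
      then have "\<exists>p. X = {j\<in>J. 0 < g c b I j p}" using P0D Q1D by blast
      then show "X \<in> pat c b I J" by (auto simp: pat_def)
    qed
    also have "\<dots> \<le> (card J + 1) ^ card I" by (rule IH[OF insert.prems])
    finally show "card (P0 \<union> Q1) \<le> (card J + 1) ^ card I" .
  qed
  also have "(card J + 1) ^ card I + card (P0 \<inter> Q1) \<le> (card J + 2) ^ card I"
  proof (cases "\<exists>i\<in>I. c f i \<noteq> 0")
    case False
    then have "g c b I f p = b f" for p by (simp add: g_def)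
    then have "P0 \<inter> Q1 = {}" using P0D Q1D by fastforce
    then show ?thesis by (simp add: power_mono)
  next
    case True
    then obtain i0 where i0: "i0 \<in> I" "c f i0 \<noteq> 0" by blast
    \<comment> \<open>Solving \<open>g f p = 0\<close> for \<open>p i0\<close> turns the remaining functions into affine functions
        of the other coordinates.\<close>
    define c' where "c' j i = c j i - c j i0 / c f i0 * c f i" for j i
    define b' where "b' j = b j - c j i0 / c f i0 * b f" for j
    have elim: "g c b I j p = g c' b' (I - {i0}) j p" if "g c b I f p = 0" for j p
    proof -
      have "g c b I j p = g c b I j p - c j i0 / c f i0 * g c b I f p" using that by simp
      also have "\<dots> = g c' b' I j p"
        by (simp add: g_def c'_def b'_def algebra_simps sum.distrib sum_subtractf sum_distrib_left)
      also have "\<dots> = g c' b' (I - {i0}) j p"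
        using i0 by (simp add: g_def sum.remove[OF insert.prems i0(1)] c'_def)
      finally show ?thesis .
    qed
    have "P0 \<inter> Q1 \<subseteq> pat c' b' (I - {i0}) J"
    proof
      fix X assume X: "X \<in> P0 \<inter> Q1"
      obtain p where p: "X = {j\<in>J. 0 < g c b I j p}" "g c b I f p \<le> 0" using P0D X by blast
      obtain r where r: "X = {j\<in>J. 0 < g c b I j r}" "0 < g c b I f r" using Q1D X by blast
      \<comment> \<open>The weight for which \<open>f\<close> vanishes at the point \<open>s\<close>
        of the segment from \<open>p\<close> to \<open>r\<close>. Signs shared by both endpoints
        persist along the segment; \<open>u > 0\<close> keeps strict positivity even when
        \<open>f\<close> already vanishes at \<open>p\<close>, where \<open>s = p\<close>.\<close>
      define u where "u = g c b I f r / (g c b I f r - g c b I f p)"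
      have u: "0 < u" "u \<le> 1" using p r by (auto simp: u_def field_simps)
      define s where "s = (\<lambda>i. u * p i + (1 - u) * r i)"
      have gs: "g c b I j s = u * g c b I j p + (1 - u) * g c b I j r" for j
        by (simp add: g_def s_def algebra_simps sum.distrib sum_subtractf sum_distrib_left)
      have "u * (g c b I f r - g c b I f p) = g c b I f r" using p r by (simp add: u_def)
      then have zero: "g c b I f s = 0" unfolding gs by (simp add: algebra_simps)
      have same: "(0 < g c b I j p) = (0 < g c b I j r)" if "j \<in> J" for j
        using p(1) r(1) that by blast
      have "(0 < g c b I j s) = (0 < g c b I j p)" if "j \<in> J" for j
      proof (cases "0 < g c b I j p")
        case True
        then have "0 < g c b I j r" using same[OF that] by blast
        then have "0 \<le> (1 - u) * g c b I j r" using u by simp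
        then show ?thesis using True u unfolding gs by (simp add: add_pos_nonneg)
      next
        case False
        then have "g c b I j r \<le> 0" "g c b I j p \<le> 0"
          using same[OF that] by auto
        then have "u * g c b I j p \<le> 0" "(1 - u) * g c b I j r \<le> 0"
          using u by (auto simp: mult_nonneg_nonpos)
        then show ?thesis using False unfolding gs by simp
      qed
      then have "X = {j\<in>J. 0 < g c' b' (I - {i0}) j s}"
        using p(1) elim[OF zero] by auto
      then show "X \<in> pat c' b' (I - {i0}) J" by (auto simp: pat_def)
    qed
    then have "card (P0 \<inter> Q1) \<le> card (pat c' b' (I - {i0}) J)" by (intro card_mono fin)
    also have "\<dots> \<le> (card J + 1) ^ card (I - {i0})" using insert.prems by (intro IH) simp
    finally have 1: "card (P0 \<inter> Q1) \<le> (card J + 1) ^ card (I - {i0})" .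
    have cI: "card I = Suc (card (I - {i0}))" using i0 insert.prems by (metis card_Suc_Diff1)
    have "(card J + 1) ^ card I + card (P0 \<inter> Q1) \<le> (card J + 2) * (card J + 1) ^ card (I - {i0})"
      using 1 by (simp add: cI)
    also have "\<dots> \<le> (card J + 2) * (card J + 2) ^ card (I - {i0})"
      by (intro mult_left_mono power_mono) auto
    finally show ?thesis by (simp add: cI)
  qed
  finally show ?case using insert.hyps by (simp add: pat_def g_def)
qed

section \<open>Exchangeability and exponential tail bounds for sampling without replacement\<close>

section \<open>Uniformly random arrival orders\<close>

text \<open>With expectations written as finite averages, the linearity and monotonicity rules below
  carry no integrability conditions.\<close>

lemma expectation_random_order:
  "measure_pmf.expectation (random_order n) (f :: _ \<Rightarrow> real)
     = (\<Sum>\<sigma> | \<sigma> permutes {..<n}. f \<sigma>) / fact n"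
  unfolding random_order_def
  by (subst integral_pmf_of_set)
     (auto simp: finite_permutations card_permutations intro: exI[of _ id] permutes_id)

lemma expectation_random_order_cong:
  assumes "\<And>\<sigma>. \<sigma> permutes {..<n} \<Longrightarrow> f \<sigma> = (g \<sigma> :: real)"
  shows "measure_pmf.expectation (random_order n) f = measure_pmf.expectation (random_order n) g"
  by (simp add: expectation_random_order assms)

lemma expectation_random_order_mono:
  assumes "\<And>\<sigma>. \<sigma> permutes {..<n} \<Longrightarrow> f \<sigma> \<le> (g \<sigma> :: real)"
  shows "measure_pmf.expectation (random_order n) f \<le> measure_pmf.expectation (random_order n) g"
  unfolding expectation_random_order by (intro divide_right_mono sum_mono) (auto intro: assms)

lemma expectation_random_order_add:
  "measure_pmf.expectation (random_order n) (\<lambda>\<sigma>. f \<sigma> + (g \<sigma> :: real))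
     = measure_pmf.expectation (random_order n) f + measure_pmf.expectation (random_order n) g"
  by (simp add: expectation_random_order sum.distrib add_divide_distrib)

lemma expectation_random_order_diff:
  "measure_pmf.expectation (random_order n) (\<lambda>\<sigma>. f \<sigma> - (g \<sigma> :: real))
     = measure_pmf.expectation (random_order n) f - measure_pmf.expectation (random_order n) g"
  by (simp add: expectation_random_order sum_subtractf diff_divide_distrib)

lemma expectation_random_order_sum:
  "measure_pmf.expectation (random_order n) (\<lambda>\<sigma>. \<Sum>i\<in>A. (f i \<sigma> :: real))
     = (\<Sum>i\<in>A. measure_pmf.expectation (random_order n) (f i))"
  unfolding expectation_random_order by (subst sum.swap) (simp add: sum_divide_distrib)

text \<open>Exchangeability of arrival times: precomposition with a transposition is an involution
  on the permutations.\<close>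

lemma expectation_random_order_swap:
  assumes "i < n" "j < n"
  shows "measure_pmf.expectation (random_order n) (\<lambda>\<sigma>. f (\<sigma> \<circ> Transposition.transpose i j) :: real)
     = measure_pmf.expectation (random_order n) f"
proof -
  have t: "Transposition.transpose i j permutes {..<n}" using assms by (intro permutes_swap_id) auto
  have "(\<Sum>\<sigma> | \<sigma> permutes {..<n}. f (\<sigma> \<circ> Transposition.transpose i j)) = (\<Sum>\<sigma> | \<sigma> permutes {..<n}. f \<sigma>)"
    by (rule sum.reindex_bij_witness[where i="\<lambda>\<sigma>. \<sigma> \<circ> Transposition.transpose i j"
          and j="\<lambda>\<sigma>. \<sigma> \<circ> Transposition.transpose i j"])
       (auto simp: comp_assoc intro!: permutes_compose[OF t])
  then show ?thesis by (simp add: expectation_random_order)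
qed

text \<open>Sampling without replacement is dominated by sampling with replacement. An extra factor
  at a fresh position has expectation \<open>v\<close>, whichever fresh position is taken, and at a
  position already used it has at least that. Averaging over all \<open>n\<close> positions turns
  the extra factor into the overall mean.\<close>

lemma expectation_prod_random_order_le:
  fixes y :: "nat \<Rightarrow> real"
  assumes y: "\<And>t. t < n \<Longrightarrow> 0 \<le> y t" and "s \<le> n" and n: "0 < n"
  shows "measure_pmf.expectation (random_order n) (\<lambda>\<sigma>. \<Prod>k<s. y (\<sigma> k)) \<le> ((\<Sum>t<n. y t) / n) ^ s"
  using \<open>s \<le> n\<close>
proof (induction s)
  case 0
  then show ?case by simp
next
  case (Suc s)
  let ?E = "measure_pmf.expectation (random_order n) :: ((nat \<Rightarrow> nat) \<Rightarrow> real) \<Rightarrow> real"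
  define P where "P \<sigma> = (\<Prod>k<s. y (\<sigma> k))" for \<sigma> :: "nat \<Rightarrow> nat"
  define Y where "Y = (\<Sum>t<n. y t)"
  have y': "0 \<le> y (\<sigma> k)" if "\<sigma> permutes {..<n}" "k < n" for \<sigma> k
    using y permutes_in_image[OF that(1), of k] that(2) by simp
  have Y0: "0 \<le> Y" unfolding Y_def using y by (intro sum_nonneg) auto
  define v where "v = ?E (\<lambda>\<sigma>. P \<sigma> * y (\<sigma> s))"
  have after: "?E (\<lambda>\<sigma>. P \<sigma> * y (\<sigma> k)) = v" if "s \<le> k" "k < n" for k
  proof -
    have "P (\<sigma> \<circ> Transposition.transpose s k) = P \<sigma>" for \<sigma>
      unfolding P_def using that by (intro prod.cong) (auto simp: Transposition.transpose_def)
    then show ?thesis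
      using expectation_random_order_swap[of s n k "\<lambda>\<sigma>. P \<sigma> * y (\<sigma> k)"] that Suc.prems
      by (simp add: v_def)
  qed
  \<comment> \<open>Exchanging positions \<open>k\<close> and \<open>s\<close> shows that the difference of the two sides is half the
      expectation of a product containing the square \<open>(y (\<sigma> k) - y (\<sigma> s))\<^sup>2\<close>.\<close>
  have before: "v \<le> ?E (\<lambda>\<sigma>. P \<sigma> * y (\<sigma> k))" if "k < s" for k
  proof -
    define R where "R \<sigma> = (\<Prod>j\<in>{..<s}-{k}. y (\<sigma> j))" for \<sigma> :: "nat \<Rightarrow> nat"
    have PR: "P \<sigma> = y (\<sigma> k) * R \<sigma>" for \<sigma>
      unfolding P_def R_def using that by (subst prod.remove[of _ k]) auto
    have Rswap: "R (\<sigma> \<circ> Transposition.transpose k s) = R \<sigma>" for \<sigma>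
      unfolding R_def by (intro prod.cong) (auto simp: Transposition.transpose_def)
    define f where "f \<sigma> = R \<sigma> * y (\<sigma> k) * (y (\<sigma> k) - y (\<sigma> s))" for \<sigma>
    have "?E f = ?E (\<lambda>\<sigma>. R \<sigma> * y (\<sigma> s) * (y (\<sigma> s) - y (\<sigma> k)))"
      using expectation_random_order_swap[of k n s f] that Suc.prems
      by (simp add: f_def Rswap)
    then have "2 * ?E f = ?E (\<lambda>\<sigma>. f \<sigma> + R \<sigma> * y (\<sigma> s) * (y (\<sigma> s) - y (\<sigma> k)))"
      by (simp add: expectation_random_order_add)
    also have "\<dots> \<ge> ?E (\<lambda>_. 0)"
    proof (rule expectation_random_order_mono)
      fix \<sigma> assume s: "\<sigma> permutes {..<n}"
      have "f \<sigma> + R \<sigma> * y (\<sigma> s) * (y (\<sigma> s) - y (\<sigma> k)) = R \<sigma> * (y (\<sigma> k) - y (\<sigma> s))\<^sup>2"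
        by (simp add: f_def power2_eq_square algebra_simps)
      also have "0 \<le> R \<sigma>" unfolding R_def using y'[OF s] Suc.prems by (intro prod_nonneg) auto
      then have "0 \<le> R \<sigma> * (y (\<sigma> k) - y (\<sigma> s))\<^sup>2" by simp
      finally show "0 \<le> f \<sigma> + R \<sigma> * y (\<sigma> s) * (y (\<sigma> s) - y (\<sigma> k))" .
    qed
    finally have "0 \<le> ?E f" by simp
    moreover have "?E f = ?E (\<lambda>\<sigma>. P \<sigma> * y (\<sigma> k)) - v"
      unfolding v_def expectation_random_order_diff[symmetric] f_def PR
      by (simp add: algebra_simps)
    ultimately show ?thesis by simp
  qed
  have "real n * v = (\<Sum>k<n. v)" by simp
  also have "\<dots> \<le> (\<Sum>k<n. ?E (\<lambda>\<sigma>. P \<sigma> * y (\<sigma> k)))"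
    using after before by (intro sum_mono) (metis lessThan_iff linorder_not_less order_refl)
  also have "\<dots> = ?E (\<lambda>\<sigma>. \<Sum>k<n. P \<sigma> * y (\<sigma> k))" by (simp add: expectation_random_order_sum)
  also have "\<dots> = ?E (\<lambda>\<sigma>. P \<sigma> * Y)"
  proof (rule expectation_random_order_cong)
    fix \<sigma> assume "\<sigma> permutes {..<n}"
    then have "(\<Sum>k<n. y (\<sigma> k)) = Y"
      unfolding Y_def by (metis comp_apply sum.permute sum.cong)
    then show "(\<Sum>k<n. P \<sigma> * y (\<sigma> k)) = P \<sigma> * Y" by (simp add: sum_distrib_left[symmetric])
  qed
  also have "\<dots> = Y * ?E P" by simp
  also have "\<dots> \<le> Y * (Y / n) ^ s"
    using Suc Y0 by (intro mult_left_mono) (auto simp: P_def[abs_def] Y_def)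
  finally have "v \<le> (Y / n) ^ Suc s" using n by (simp add: field_simps)
  then show ?case by (simp add: v_def P_def Y_def)
qed

text \<open>The chord of the convex function exp over [0,1], followed by 1 + z \<le> exp z, bounds
  the moment generating function by that of a Poisson variable with the same mean. The sign of
  \<open>l\<close> is arbitrary.\<close>

lemma expectation_exp_sample_le:
  fixes x :: "nat \<Rightarrow> real" and l :: real
  assumes x: "\<And>t. t < n \<Longrightarrow> 0 \<le> x t \<and> x t \<le> 1" and "s \<le> n" and n: "0 < n"
  shows "measure_pmf.expectation (random_order n) (\<lambda>\<sigma>. exp (l * (\<Sum>k<s. x (\<sigma> k))))
     \<le> exp (real s / real n * (\<Sum>t<n. x t) * (exp l - 1))"
proof -
  have convex: "exp (l * u) \<le> 1 + u * (exp l - 1)" if "0 \<le> u" "u \<le> 1" for u :: real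
    using convex_onD[OF exp_convex, of u 0 l] that by (simp add: algebra_simps)
  have "measure_pmf.expectation (random_order n) (\<lambda>\<sigma>. exp (l * (\<Sum>k<s. x (\<sigma> k))))
      = measure_pmf.expectation (random_order n) (\<lambda>\<sigma>. \<Prod>k<s. exp (l * x (\<sigma> k)))"
    by (simp add: sum_distrib_left exp_sum)
  also have "\<dots> \<le> ((\<Sum>t<n. exp (l * x t)) / n) ^ s"
    using expectation_prod_random_order_le[of n "\<lambda>t. exp (l * x t)" s] assms by simp
  also have "\<dots> \<le> exp ((\<Sum>t<n. x t) / n * (exp l - 1)) ^ s"
  proof (rule power_mono)
    have "(\<Sum>t<n. exp (l * x t)) \<le> (\<Sum>t<n. 1 + x t * (exp l - 1))"
      using convex x by (intro sum_mono) auto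
    also have "\<dots> = n * (1 + (\<Sum>t<n. x t) / n * (exp l - 1))"
      using n by (simp add: sum.distrib sum_distrib_right[symmetric] distrib_left)
    also have "\<dots> \<le> n * exp ((\<Sum>t<n. x t) / n * (exp l - 1))"
      by (intro mult_left_mono exp_ge_add_one_self) auto
    finally show "(\<Sum>t<n. exp (l * x t)) / n \<le> exp ((\<Sum>t<n. x t) / n * (exp l - 1))"
      using n by (simp add: field_simps)
  qed (intro divide_nonneg_nonneg sum_nonneg, auto)
  also have "\<dots> = exp (real s / real n * (\<Sum>t<n. x t) * (exp l - 1))"
    by (simp add: exp_of_nat_mult[symmetric])
  finally show ?thesis .
qed

text \<open>Markov's inequality for the exponential. Keeping the factor \<open>l\<close> in the
  event covers both tails: upper for positive \<open>l\<close>, lower for negative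
  \<open>l\<close>.\<close>

lemma prob_sample_exp_le:
  fixes x :: "nat \<Rightarrow> real" and l z :: real
  assumes "\<And>t. t < n \<Longrightarrow> 0 \<le> x t \<and> x t \<le> 1" and "s \<le> n" and "0 < n"
  shows "measure_pmf.prob (random_order n) {\<sigma>. l * z \<le> l * (\<Sum>k<s. x (\<sigma> k))}
     \<le> exp (real s / real n * (\<Sum>t<n. x t) * (exp l - 1) - l * z)"
proof -
  let ?E = "measure_pmf.expectation (random_order n) :: ((nat \<Rightarrow> nat) \<Rightarrow> real) \<Rightarrow> real"
  let ?A = "{\<sigma>. l * z \<le> l * (\<Sum>k<s. x (\<sigma> k))}"
  have "measure_pmf.prob (random_order n) ?A = ?E (indicator ?A)" by simp
  also have "\<dots> \<le> ?E (\<lambda>\<sigma>. exp (l * (\<Sum>k<s. x (\<sigma> k))) * exp (- (l * z)))"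
    by (rule expectation_random_order_mono) (auto simp: indicator_def exp_add[symmetric])
  also have "\<dots> \<le> exp (real s / real n * (\<Sum>t<n. x t) * (exp l - 1)) * exp (- (l * z))"
    using expectation_exp_sample_le[OF assms, where l=l] by simp
  finally show ?thesis by (simp add: exp_diff exp_minus field_simps)
qed

section \<open>Levels of price vectors and the sets squeezing their choices\<close>

section \<open>Packing problems with few column directions\<close>

text \<open>Columns are split into a length \<open>w\<close> and a direction \<open>q\<close> of sup
  norm 1. \<open>N\<close> is the resolution at which the weights of the directions are
  recorded.\<close>

locale directional_lp =
  fixes m n N :: nat and B :: real and \<pi> w :: "nat \<Rightarrow> real" and q :: "nat \<Rightarrow> nat \<Rightarrow> real"
  assumes n_pos: "0 < n" and N_pos: "0 < N" and B_pos: "0 < B"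
    and weight: "\<And>t. t < n \<Longrightarrow> 0 < w t \<and> w t \<le> 1"
    and direction: "\<And>t i. t < n \<Longrightarrow> i < m \<Longrightarrow> 0 \<le> q t i \<and> q t i \<le> 1"
    and direction_one: "\<And>t. t < n \<Longrightarrow> \<exists>i<m. q t i = 1"
begin

definition col :: "nat \<Rightarrow> nat \<Rightarrow> real" where
  "col t i = w t * q t i"

text \<open>Entries from \<open>m\<close> on are cleared so that directions agreeing on the relevant
  coordinates are equal as functions and can be counted.\<close>

definition dir :: "nat \<Rightarrow> nat \<Rightarrow> real" where
  "dir t = (\<lambda>i. if i < m then q t i else 0)"

definition dirs :: "(nat \<Rightarrow> real) set" where
  "dirs = dir ` {..<n}"

definition chosen :: "(nat \<Rightarrow> real) \<Rightarrow> nat set" where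
  "chosen p = {t. t < n \<and> dot m p (col t) < \<pi> t}"

definition load :: "nat \<Rightarrow> nat set \<Rightarrow> real" where
  "load i A = (\<Sum>t\<in>A. col t i)"

definition dir_weight :: "(nat \<Rightarrow> real) \<Rightarrow> nat set \<Rightarrow> real" where
  "dir_weight d A = (\<Sum>t | t \<in> A \<and> dir t = d. w t)"

text \<open>The threshold for \<open>k = N\<close> is \<open>B\<close> itself, so a level also
  records which directions alone exceed the capacity; weights beyond \<open>B\<close> are not
  resolved further.\<close>

definition level :: "(nat \<Rightarrow> real) \<Rightarrow> ((nat \<Rightarrow> real) \<times> nat) set" where
  "level p = {(d, k). d \<in> dirs \<and> k \<le> N \<and> k * B / N < dir_weight d (chosen p)}"

text \<open>\<open>lower\<close> and \<open>upper\<close> do not depend on the arrival order, so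
  tail bounds apply to them; they do not apply to \<open>chosen p\<close> when \<open>p\<close> is
  computed from the sample.\<close>

definition lower :: "((nat \<Rightarrow> real) \<times> nat) set \<Rightarrow> nat set" where
  "lower l = {t. t < n \<and> (\<forall>p. level p = l \<longrightarrow> t \<in> chosen p)}"

definition upper :: "((nat \<Rightarrow> real) \<times> nat) set \<Rightarrow> nat set" where
  "upper l = {t. t < n \<and> (\<exists>p. level p = l \<and> t \<in> chosen p)}"

lemma chosen_subset: "chosen p \<subseteq> {..<n}" by (auto simp: chosen_def)
lemma lower_subset: "lower l \<subseteq> {..<n}" by (auto simp: lower_def)
lemma upper_subset: "upper l \<subseteq> {..<n}" by (auto simp: upper_def)
lemma lower_chosen: "lower (level p) \<subseteq> chosen p" by (auto simp: lower_def)
lemma chosen_upper: "chosen p \<subseteq> upper (level p)" by (auto simp: upper_def chosen_def)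

lemma finite_dirs: "finite dirs" by (simp add: dirs_def)

lemma col_bounds: "0 \<le> col t i" "col t i \<le> w t" "col t i \<le> 1" if "t < n" "i < m"
proof -
  have w: "0 < w t" "w t \<le> 1" and q: "0 \<le> q t i" "q t i \<le> 1"
    using weight direction that by auto
  show "0 \<le> col t i" using w q by (simp add: col_def)
  show "col t i \<le> w t" using w q by (simp add: col_def mult_left_le)
  then show "col t i \<le> 1" using w by simp
qed

lemma chosen_dir:
  "{t. t \<in> chosen p \<and> dir t = d} = {t. t < n \<and> dir t = d \<and> w t * dot m p d < \<pi> t}"
proof -
  have "dot m p (col t) = w t * dot m p (dir t)" for t
    unfolding dot_def sum_distrib_left by (intro sum.cong) (auto simp: col_def dir_def)
  then show ?thesis by (auto simp: chosen_def)
qed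

text \<open>Within one direction the prices enter only through the number \<open>dot m p d\<close>,
  and decreasing it can only add columns.\<close>

lemma chosen_dir_nested:
  "{t. t \<in> chosen p \<and> dir t = d} \<subseteq> {t. t \<in> chosen p' \<and> dir t = d} \<or>
   {t. t \<in> chosen p' \<and> dir t = d} \<subseteq> {t. t \<in> chosen p \<and> dir t = d}"
proof -
  have mono: "w t * x < \<pi> t" if "x \<le> y" "w t * y < \<pi> t" "t < n" for x y t
    using mult_left_mono[OF that(1), of "w t"] weight[OF that(3)] that(2) by linarith
  show ?thesis unfolding chosen_dir
    using mono[of "dot m p d" "dot m p' d"] mono[of "dot m p' d" "dot m p d"]
    by (cases "dot m p d \<le> dot m p' d") auto
qed

lemma sum_dir_weight:
  assumes "A \<subseteq> {..<n}"
  shows "(\<Sum>d\<in>dirs. dir_weight d A) = (\<Sum>t\<in>A. w t)"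
proof -
  have "finite A" using assms finite_subset by blast
  then show ?thesis
    using sum.group[of A dirs dir w] assms finite_dirs by (auto simp: dirs_def dir_weight_def)
qed

text \<open>An entry of a column is at most its weight, so the gap in any row is at most the gap in
  total weight, which splits over the directions.\<close>

lemma load_diff_le:
  assumes "A \<subseteq> A'" "A' \<subseteq> {..<n}" "i < m"
  shows "load i A' - load i A \<le> (\<Sum>d\<in>dirs. dir_weight d A' - dir_weight d A)"
proof -
  have fin: "finite A'" using assms finite_subset by blast
  have "load i A' - load i A = (\<Sum>t\<in>A'-A. col t i)"
    unfolding load_def using assms fin by (simp add: sum_diff)
  also have "\<dots> \<le> (\<Sum>t\<in>A'-A. w t)"
    using assms col_bounds(2) by (intro sum_mono) auto
  also have "\<dots> = (\<Sum>t\<in>A'. w t) - (\<Sum>t\<in>A. w t)" using assms fin by (simp add: sum_diff)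
  also have "\<dots> = (\<Sum>d\<in>dirs. dir_weight d A' - dir_weight d A)"
    using sum_dir_weight[of A] sum_dir_weight[of A'] assms by (simp add: sum_subtractf)
  finally show ?thesis .
qed

text \<open>In a coordinate where the direction equals 1, its columns contribute their full weight.
  The row serves all sets \<open>A\<close> at once, so that it can be carried from one chosen set to
  another.\<close>

lemma dir_weight_le_load:
  assumes "d \<in> dirs"
  shows "\<exists>j<m. \<forall>A\<subseteq>{..<n}. dir_weight d A \<le> load j A"
proof -
  obtain t where t: "t < n" "d = dir t" using assms by (auto simp: dirs_def)
  obtain j where j: "j < m" "q t j = 1" using direction_one[OF t(1)] by blast
  have "dir_weight d A \<le> load j A" if A: "A \<subseteq> {..<n}" for A
  proof -
    have fin: "finite A" using A finite_subset by blast
    have "q u j = 1" if "dir u = d" for u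
      using fun_cong[OF that, of j] j by (simp add: t(2) dir_def)
    then have "dir_weight d A = (\<Sum>u | u \<in> A \<and> dir u = d. col u j)"
      unfolding dir_weight_def by (intro sum.cong) (auto simp: col_def)
    also have "\<dots> \<le> load j A"
      unfolding load_def using A fin j col_bounds(1) by (intro sum_mono2) auto
    finally show ?thesis .
  qed
  then show ?thesis using j by blast
qed

text \<open>The weight is a decreasing step function of \<open>dot m p d\<close>. It exceeds
  \<open>z\<close> exactly when \<open>dot m p d\<close> lies below the largest ratio
  \<open>x\<close> such that the columns of ratio at least \<open>x\<close> weigh more than
  \<open>z\<close>. If there is no such ratio, the zero function serves.\<close>

lemma dir_weight_threshold:
  assumes "0 \<le> z"
  shows "\<exists>c b. \<forall>p. z < dir_weight d (chosen p) \<longleftrightarrow> 0 < (\<Sum>i<m. p i * c i) + b"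
proof -
  define r where "r t = \<pi> t / w t" for t
  define T where "T = {t. t < n \<and> dir t = d}"
  define V where "V x = (\<Sum>t | t \<in> T \<and> x \<le> r t. w t)" for x
  define R where "R = {x \<in> r ` T. z < V x}"
  have finT: "finite T" by (simp add: T_def)
  then have finR: "finite R" by (simp add: R_def)
  have above: "(w t * x < \<pi> t) = (x < r t)" if "t \<in> T" for t x
    using weight[of t] that by (simp add: T_def r_def field_simps)
  have W: "dir_weight d (chosen p) = (\<Sum>t | t \<in> T \<and> dot m p d < r t. w t)" for p
    unfolding dir_weight_def chosen_dir
    using above by (intro sum.cong) (auto simp: T_def)
  have iff: "z < dir_weight d (chosen p) \<longleftrightarrow> (\<exists>x\<in>R. dot m p d < x)" for p
  proof
    assume z: "z < dir_weight d (chosen p)"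
    define S where "S = {t. t \<in> T \<and> dot m p d < r t}"
    have "S \<noteq> {}"
    proof
      assume "S = {}"
      then have "dir_weight d (chosen p) = 0" unfolding W S_def[symmetric] by simp
      with z assms show False by simp
    qed
    moreover have finS: "finite S" using finT by (simp add: S_def)
    \<comment> \<open>The columns of the direction with at least the smallest chosen ratio are
      precisely the chosen ones, so this ratio belongs to \<open>R\<close>.\<close>
    ultimately have "Min (r ` S) \<in> r ` S" by simp
    then obtain t where t: "t \<in> S" "r t = Min (r ` S)" by auto
    have "S = {u. u \<in> T \<and> r t \<le> r u}"
      using t finS by (auto simp: S_def)
    then have "V (r t) = dir_weight d (chosen p)" unfolding W V_def S_def by simp
    then show "\<exists>x\<in>R. dot m p d < x"
      using t(1) z by (intro bexI[of _ "r t"]) (auto simp: S_def R_def)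
  next
    assume "\<exists>x\<in>R. dot m p d < x"
    then obtain x where x: "x \<in> R" "dot m p d < x" by blast
    have "z < V x" using x by (simp add: R_def)
    also have "V x \<le> dir_weight d (chosen p)"
      unfolding W V_def using x finT weight
      by (intro sum_mono2) (auto simp: T_def intro: less_imp_le)
    finally show "z < dir_weight d (chosen p)" .
  qed
  show ?thesis
  proof (cases "R = {}")
    case True
    then show ?thesis by (intro exI[of _ "\<lambda>_. 0"] exI[of _ 0]) (simp add: iff)
  next
    case False
    then have "z < dir_weight d (chosen p) \<longleftrightarrow> dot m p d < Max R" for p
      unfolding iff using Max_gr_iff[OF finR] by blast
    then show ?thesis
      by (intro exI[of _ "\<lambda>i. - d i"] exI[of _ "Max R"]) (simp add: dot_def sum_negf)
  qed
qed

lemma level_subset: "level p \<subseteq> dirs \<times> {..N}"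
  by (auto simp: level_def)

lemma finite_levels: "finite (range level)"
proof (rule finite_subset)
  show "range level \<subseteq> Pow (dirs \<times> {..N})" using level_subset by blast
qed (simp add: finite_dirs)

lemma card_levels: "card (range level) \<le> (card dirs * (N + 1) + 1) ^ m"
proof -
  define J where "J = dirs \<times> {..N}"
  have "\<forall>j :: (nat \<Rightarrow> real) \<times> nat. \<exists>c b. \<forall>p. (real (snd j) * B / N < dir_weight (fst j) (chosen p)) \<longleftrightarrow>
      0 < (\<Sum>i<m. p i * c i) + b"
    using B_pos by (intro allI dir_weight_threshold) simp
  from choice[OF this] obtain c where
    "\<forall>j. \<exists>b. \<forall>p. (real (snd j) * B / N < dir_weight (fst j) (chosen p)) \<longleftrightarrow>
      0 < (\<Sum>i<m. p i * c j i) + b"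
    by blast
  from choice[OF this] obtain b where cb:
    "\<And>j p. (real (snd j) * B / N < dir_weight (fst j) (chosen p)) \<longleftrightarrow> 0 < (\<Sum>i<m. p i * c j i) + b j"
    by blast
  have "level p = {j \<in> J. 0 < (\<Sum>i<m. p i * c j i) + b j}" for p
    unfolding cb[symmetric] by (auto simp: level_def J_def)
  then have "range level = range (\<lambda>p. {j \<in> J. 0 < (\<Sum>i<m. p i * c j i) + b j})" by simp
  then show ?thesis
    using card_affine_patterns[of J "{..<m}" c b] finite_dirs by (simp add: J_def)
qed

lemma level_iff:
  assumes "level p = level p'" "d \<in> dirs" "k \<le> N"
  shows "k * B / N < dir_weight d (chosen p) \<longleftrightarrow> k * B / N < dir_weight d (chosen p')"
proof -
  have "(d, k) \<in> level p \<longleftrightarrow> (d, k) \<in> level p'" using assms(1) by simp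
  then show ?thesis using assms by (simp add: level_def)
qed

lemma level_iff_B:
  assumes "level p = level p'" "d \<in> dirs"
  shows "B < dir_weight d (chosen p) \<longleftrightarrow> B < dir_weight d (chosen p')"
  using level_iff[OF assms, of N] N_pos by simp

text \<open>A larger gap would leave room for a multiple of B / N that is at least the smaller
  weight and strictly below the larger one. Since the larger weight is at most \<open>B\<close>,
  this multiple is among the recorded thresholds, and the two levels would differ.\<close>

lemma dir_weight_gap:
  assumes l: "level p = level p'" and d: "d \<in> dirs" and le: "dir_weight d (chosen p) \<le> B"
  shows "dir_weight d (chosen p) \<le> dir_weight d (chosen p') + B / N"
proof (rule ccontr)
  let ?x = "dir_weight d (chosen p)" and ?y = "dir_weight d (chosen p')"
  assume "\<not> ?x \<le> ?y + B / N"
  then have gap: "?y + B / N < ?x" by simp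
  have y0: "0 \<le> ?y"
    unfolding dir_weight_def using weight by (intro sum_nonneg) (auto simp: chosen_def intro: less_imp_le)
  define k where "k = nat \<lceil>?y * N / B\<rceil>"
  have "0 \<le> ?y * N / B" using y0 B_pos by simp
  then have k: "?y * N / B \<le> k" "k < ?y * N / B + 1" unfolding k_def by linarith+
  have ky: "?y \<le> k * B / N" using k(1) B_pos N_pos by (simp add: field_simps)
  have "k * B / N < ?y + B / N" using k(2) B_pos N_pos by (simp add: field_simps)
  with gap have kx: "k * B / N < ?x" by simp
  with le have "k * B / N < B" by simp
  then have "k \<le> N" using B_pos N_pos by (simp add: field_simps)
  from level_iff[OF l d this] kx ky show False by simp
qed

text \<open>In one direction the chosen sets of a level form a chain, so their intersection is the
  member of least cardinality. The witness \<open>p'\<close> may change with the direction.\<close>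

lemma lower_dir:
  "\<exists>p'. level p' = level p \<and>
     {t. t \<in> lower (level p) \<and> dir t = d} = {t. t \<in> chosen p' \<and> dir t = d}"
proof -
  let ?X = "\<lambda>p. {t. t \<in> chosen p \<and> dir t = d}"
  obtain p' where p': "level p' = level p"
    and least: "\<And>p''. level p'' = level p \<Longrightarrow> card (?X p') \<le> card (?X p'')"
    using ex_has_least_nat[of "\<lambda>p'. level p' = level p" p "\<lambda>p. card (?X p)"] by auto
  have fin: "finite (?X p)" for p
    by (rule finite_subset[of _ "{..<n}"]) (use chosen_subset in auto)
  have sub: "?X p' \<subseteq> ?X p''" if "level p'' = level p" for p''
    using chosen_dir_nested[of p' d p''] card_seteq[OF fin, of "?X p''" p'] least[OF that] by blast
  have "{t. t \<in> lower (level p) \<and> dir t = d} = ?X p'"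
  proof (intro equalityI subsetI)
    fix t assume "t \<in> {t. t \<in> lower (level p) \<and> dir t = d}"
    then show "t \<in> ?X p'" using p' by (auto simp: lower_def)
  next
    fix t assume t: "t \<in> ?X p'"
    then have "t < n" using chosen_subset by blast
    then show "t \<in> {t. t \<in> lower (level p) \<and> dir t = d}"
      using sub t unfolding lower_def by blast
  qed
  with p' show ?thesis by blast
qed

text \<open>Dually, the union of the chain is its member of greatest cardinality, which exists
  because cardinalities are at most \<open>n\<close>.\<close>

lemma upper_dir:
  "\<exists>p'. level p' = level p \<and>
     {t. t \<in> upper (level p) \<and> dir t = d} = {t. t \<in> chosen p' \<and> dir t = d}"
proof -
  let ?X = "\<lambda>p. {t. t \<in> chosen p \<and> dir t = d}"
  have fin: "finite (?X p)" for p
    by (rule finite_subset[of _ "{..<n}"]) (use chosen_subset in auto)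
  have "card (?X p) \<le> n" for p
    using card_mono[of "{..<n}" "?X p"] chosen_subset by auto
  then obtain p' where p': "level p' = level p"
    and most: "\<And>p''. level p'' = level p \<Longrightarrow> card (?X p'') \<le> card (?X p')"
    using ex_has_greatest_nat[of "\<lambda>p'. level p' = level p" p "\<lambda>p. card (?X p)" "Suc n"]
    by (auto simp: le_imp_less_Suc)
  have sub: "?X p'' \<subseteq> ?X p'" if "level p'' = level p" for p''
    using chosen_dir_nested[of p'' d p'] card_seteq[OF fin, of "?X p'" p''] most[OF that] by blast
  have "{t. t \<in> upper (level p) \<and> dir t = d} = ?X p'"
  proof (intro equalityI subsetI)
    fix t assume "t \<in> {t. t \<in> upper (level p) \<and> dir t = d}"
    then show "t \<in> ?X p'" using sub unfolding upper_def by blast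
  next
    fix t assume t: "t \<in> ?X p'"
    then have "t < n" using chosen_subset by blast
    then show "t \<in> {t. t \<in> upper (level p) \<and> dir t = d}"
      using p' t unfolding upper_def by blast
  qed
  with p' show ?thesis by blast
qed

text \<open>If a direction alone weighs more than \<open>B\<close>, the level forces this on
  \<open>lower\<close> too, and the overload shows in a row \<open>j\<close> of that direction,
  possibly different from \<open>i\<close>. Otherwise each direction loses at most B / N and row
  \<open>i\<close> itself remains nearly full.\<close>

lemma load_lower_ge:
  assumes "i < m" "B < load i (chosen p)"
  shows "\<exists>j<m. B - card dirs * (B / N) < load j (lower (level p))"
proof (cases "\<exists>d\<in>dirs. B < dir_weight d (chosen p)")
  case True
  then obtain d where d: "d \<in> dirs" "B < dir_weight d (chosen p)" by blast
  obtain p' where p': "level p' = level p"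
    "{t. t \<in> lower (level p) \<and> dir t = d} = {t. t \<in> chosen p' \<and> dir t = d}"
    using lower_dir by blast
  obtain j where j: "j < m" "\<And>A. A \<subseteq> {..<n} \<Longrightarrow> dir_weight d A \<le> load j A"
    using dir_weight_le_load[OF d(1)] by blast
  have "B < dir_weight d (chosen p')" using level_iff_B[OF p'(1) d(1)] d(2) by simp
  also have "\<dots> = dir_weight d (lower (level p))" unfolding dir_weight_def p'(2) ..
  also have "\<dots> \<le> load j (lower (level p))" by (rule j(2)[OF lower_subset])
  moreover have "0 \<le> card dirs * (B / N)" using B_pos by simp
  ultimately show ?thesis using j(1) by (intro exI[of _ j]) auto
next
  case False
  have "dir_weight d (chosen p) - dir_weight d (lower (level p)) \<le> B / N" if d: "d \<in> dirs" for d
  proof -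
    obtain p' where p': "level p' = level p"
      "{t. t \<in> lower (level p) \<and> dir t = d} = {t. t \<in> chosen p' \<and> dir t = d}"
      using lower_dir by blast
    have "dir_weight d (chosen p) \<le> dir_weight d (chosen p') + B / N"
      using False d p'(1) by (intro dir_weight_gap) auto
    also have "dir_weight d (chosen p') = dir_weight d (lower (level p))"
      unfolding dir_weight_def p'(2) ..
    finally show ?thesis by simp
  qed
  then have "(\<Sum>d\<in>dirs. dir_weight d (chosen p) - dir_weight d (lower (level p))) \<le> card dirs * (B / N)"
    using sum_bounded_above[of dirs _ "B / N"] by simp
  with load_diff_le[OF lower_chosen chosen_subset assms(1), of p] assms
  show ?thesis by (intro exI[of _ i]) auto
qed

text \<open>Feasibility keeps every direction at weight at most \<open>B\<close>, and the level
  transfers this to the \<open>p'\<close> attaining the union, so \<open>dir_weight_gap\<close>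
  applies with \<open>p'\<close> as the heavier side.\<close>

lemma load_upper_le:
  assumes "i < m" "\<And>j. j < m \<Longrightarrow> load j (chosen p) \<le> B"
  shows "load i (upper (level p)) \<le> load i (chosen p) + card dirs * (B / N)"
proof -
  have "dir_weight d (upper (level p)) - dir_weight d (chosen p) \<le> B / N" if d: "d \<in> dirs" for d
  proof -
    obtain p' where p': "level p' = level p"
      "{t. t \<in> upper (level p) \<and> dir t = d} = {t. t \<in> chosen p' \<and> dir t = d}"
      using upper_dir by blast
    obtain j where "j < m" "dir_weight d (chosen p) \<le> load j (chosen p)"
      using dir_weight_le_load[OF d] chosen_subset by blast
    then have "\<not> B < dir_weight d (chosen p)" using assms(2)[of j] by simp
    then have "dir_weight d (chosen p') \<le> B" using level_iff_B[OF p'(1) d] by simp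
    then have "dir_weight d (chosen p') \<le> dir_weight d (chosen p) + B / N"
      using d p'(1) by (intro dir_weight_gap)
    moreover have "dir_weight d (chosen p') = dir_weight d (upper (level p))"
      unfolding dir_weight_def p'(2) ..
    ultimately show ?thesis by simp
  qed
  then have "(\<Sum>d\<in>dirs. dir_weight d (upper (level p)) - dir_weight d (chosen p)) \<le> card dirs * (B / N)"
    using sum_bounded_above[of dirs _ "B / N"] by simp
  with load_diff_le[OF chosen_upper upper_subset assms(1), of p] show ?thesis by linarith
qed

end

section \<open>Good samples, uniformly over all price vectors\<close>

section \<open>Concentration of the sampled loads\<close>

text \<open>The quadratic Taylor bound for exp x is inverted using (1 - x + x^2/2) (1 + x + x^2/2) =
  1 + x^4/4.\<close>

lemma exp_minus_le_quadratic:
  assumes "0 \<le> (x::real)"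
  shows "exp (- x) \<le> 1 - x + x\<^sup>2 / 2"
proof -
  have *: "0 < 1 + x + x\<^sup>2 / 2" using assms by (simp add: add_pos_nonneg)
  have "exp (- x) = 1 / exp x" by (simp add: exp_minus inverse_eq_divide)
  also have "\<dots> \<le> 1 / (1 + x + x\<^sup>2 / 2)"
    using exp_lower_Taylor_quadratic[OF assms] * by (intro divide_left_mono) auto
  also have "\<dots> \<le> 1 - x + x\<^sup>2 / 2"
  proof -
    have "(1 - x + x\<^sup>2 / 2) * (1 + x + x\<^sup>2 / 2) = 1 + (x\<^sup>2 / 2)\<^sup>2"
      by (simp add: field_simps power2_eq_square)
    then have "1 \<le> (1 - x + x\<^sup>2 / 2) * (1 + x + x\<^sup>2 / 2)" by simp
    then show ?thesis using * by (simp add: divide_le_eq)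
  qed
  finally show ?thesis .
qed

text \<open>The assumption \<open>fine\<close> limits the squeezing error over all directions to
  epsilon B / 2.\<close>

locale sampled_directional_lp = directional_lp +
  fixes \<epsilon> :: real and s :: nat
  assumes eps_pos: "0 < \<epsilon>" and eps_small: "\<epsilon> < 1 / 10"
    and sample: "real s = \<epsilon> * real n"
    and fine: "2 * real (card dirs) \<le> \<epsilon> * real N"
    and profit: "\<And>t. t < n \<Longrightarrow> 0 \<le> \<pi> t"
begin

definition sample_load :: "nat \<Rightarrow> nat set \<Rightarrow> (nat \<Rightarrow> nat) \<Rightarrow> real" where
  "sample_load i A \<sigma> = (\<Sum>k<s. if \<sigma> k \<in> A then col (\<sigma> k) i else 0)"

text \<open>In the first case the sampled load falls below its mean by at least epsilon^2 B / 2; in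
  the second it exceeds its mean by at least epsilon^2 B. The load thresholds already include the
  squeezing error.\<close>

definition bad :: "(nat \<Rightarrow> nat) \<Rightarrow> bool" where
  "bad \<sigma> \<longleftrightarrow> (\<exists>l\<in>range level. \<exists>j<m.
     ((1 - \<epsilon> / 2) * B \<le> load j (lower l) \<and> sample_load j (lower l) \<sigma> \<le> \<epsilon> * (1 - \<epsilon>) * B) \<or>
     (load j (upper l) \<le> (1 - 5 / 2 * \<epsilon>) * B \<and>
        \<epsilon> * (1 - 3 / 2 * \<epsilon>) * B \<le> sample_load j (upper l) \<sigma>))"

lemma sample_le: "s \<le> n"
proof -
  have "real s \<le> 1 * real n" unfolding sample using eps_small by (intro mult_right_mono) auto
  then show ?thesis by simp
qed

lemma prob_sample_load:
  assumes "A \<subseteq> {..<n}" "j < m"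
  shows "measure_pmf.prob (random_order n) {\<sigma>. x * z \<le> x * sample_load j A \<sigma>}
     \<le> exp (\<epsilon> * load j A * (exp x - 1) - x * z)"
proof -
  have "(\<Sum>t<n. if t \<in> A then col t j else 0) = load j A"
    unfolding load_def using assms(1) by (simp add: sum.If_cases Int_absorb1)
  moreover have "real s / real n = \<epsilon>" using sample n_pos by simp
  ultimately show ?thesis
    using prob_sample_exp_le[of n "\<lambda>t. if t \<in> A then col t j else 0" s x z]
      sample_le n_pos col_bounds assms by (simp add: sample_load_def)
qed

lemma prob_sample_load_small:
  assumes A: "A \<subseteq> {..<n}" "j < m" and load: "(1 - \<epsilon> / 2) * B \<le> load j A"
  shows "measure_pmf.prob (random_order n) {\<sigma>. sample_load j A \<sigma> \<le> \<epsilon> * (1 - \<epsilon>) * B}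
    \<le> exp (- (\<epsilon> ^ 3 * B / 8))"
proof -
  \<comment> \<open>To leading order the exponent is epsilon B (x^2/2 - epsilon x/2), minimal at
    this \<open>x\<close>.\<close>
  define x where "x = \<epsilon> / 2"
  let ?z = "\<epsilon> * (1 - \<epsilon>) * B"
  have x: "0 < x" "x < 1" using eps_pos eps_small by (auto simp: x_def)
  have q: "exp (- x) - 1 \<le> - x + x\<^sup>2 / 2" using exp_minus_le_quadratic[of x] x by simp
  have neg: "- x + x\<^sup>2 / 2 \<le> 0" using x by (simp add: power2_eq_square mult_left_le)
  have e0: "0 \<le> (1 - \<epsilon> / 2) * B" using B_pos eps_small by simp
  have "load j A * (exp (- x) - 1) \<le> load j A * (- x + x\<^sup>2 / 2)"
    using q load e0 by (intro mult_left_mono) auto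
  also have "\<dots> \<le> (1 - \<epsilon> / 2) * B * (- x + x\<^sup>2 / 2)"
    using load neg by (intro mult_right_mono_neg) auto
  finally have "\<epsilon> * load j A * (exp (- x) - 1) + x * ?z
      \<le> \<epsilon> * ((1 - \<epsilon> / 2) * B * (- x + x\<^sup>2 / 2)) + x * ?z"
    using eps_pos by simp
  also have "\<dots> = - (\<epsilon> ^ 3 * B / 8) - \<epsilon> ^ 4 * B / 16"
    by (simp add: x_def field_simps power2_eq_square power3_eq_cube power4_eq_xxxx)
  also have "\<dots> \<le> - (\<epsilon> ^ 3 * B / 8)" using eps_pos B_pos by simp
  finally have e: "exp (\<epsilon> * load j A * (exp (- x) - 1) - - x * ?z) \<le> exp (- (\<epsilon> ^ 3 * B / 8))"
    by simp
  have "{\<sigma>. sample_load j A \<sigma> \<le> ?z} = {\<sigma>. - x * ?z \<le> - x * sample_load j A \<sigma>}"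
    using x(1) by (simp only: mult_le_cancel_left_neg neg_less_0_iff_less)
  with order_trans[OF prob_sample_load[OF A, of "- x" ?z] e] show ?thesis by simp
qed

lemma prob_sample_load_large:
  assumes A: "A \<subseteq> {..<n}" "j < m" and load: "load j A \<le> (1 - 5 / 2 * \<epsilon>) * B"
  shows "measure_pmf.prob (random_order n) {\<sigma>. \<epsilon> * (1 - 3 / 2 * \<epsilon>) * B \<le> sample_load j A \<sigma>}
    \<le> exp (- (\<epsilon> ^ 3 * B / 8))"
proof -
  \<comment> \<open>Here the leading part is epsilon B (x^2 - epsilon x), with the same
    minimizer.\<close>
  define x where "x = \<epsilon> / 2"
  let ?z = "\<epsilon> * (1 - 3 / 2 * \<epsilon>) * B"
  have x: "0 < x" "x < 1" using eps_pos eps_small by (auto simp: x_def)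
  have q: "exp x - 1 \<le> x + x\<^sup>2" using exp_bound[of x] x by simp
  have e0: "0 \<le> (1 - 5 / 2 * \<epsilon>) * B" using B_pos eps_small by simp
  have "load j A * (exp x - 1) \<le> (1 - 5 / 2 * \<epsilon>) * B * (exp x - 1)"
    using load x by (intro mult_right_mono) auto
  also have "\<dots> \<le> (1 - 5 / 2 * \<epsilon>) * B * (x + x\<^sup>2)"
    using q e0 by (intro mult_left_mono) auto
  finally have "\<epsilon> * load j A * (exp x - 1) - x * ?z
      \<le> \<epsilon> * ((1 - 5 / 2 * \<epsilon>) * B * (x + x\<^sup>2)) - x * ?z"
    using eps_pos by simp
  also have "\<dots> = - (\<epsilon> ^ 3 * B / 8) - \<epsilon> ^ 3 * B / 8 - 5 * (\<epsilon> ^ 4 * B) / 8"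
    by (simp add: x_def field_simps power2_eq_square power3_eq_cube power4_eq_xxxx)
  also have "\<dots> \<le> - (\<epsilon> ^ 3 * B / 8)" 
  proof -
    have "0 \<le> \<epsilon> ^ 3 * B" "0 \<le> \<epsilon> ^ 4 * B" using eps_pos B_pos by auto
    then show ?thesis by linarith
  qed
  finally have e: "exp (\<epsilon> * load j A * (exp x - 1) - x * ?z) \<le> exp (- (\<epsilon> ^ 3 * B / 8))"
    by simp
  have "{\<sigma>. ?z \<le> sample_load j A \<sigma>} = {\<sigma>. x * ?z \<le> x * sample_load j A \<sigma>}"
    using x(1) by (simp only: mult_le_cancel_left_pos)
  with order_trans[OF prob_sample_load[OF A, of x ?z] e] show ?thesis by simp
qed

lemma prob_bad:
  "measure_pmf.prob (random_order n) {\<sigma>. bad \<sigma>}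
     \<le> 2 * real m * real (card dirs * (N + 1) + 1) ^ m * exp (- (\<epsilon> ^ 3 * B / 8))"
proof -
  let ?P = "measure_pmf.prob (random_order n)" and ?e = "exp (- (\<epsilon> ^ 3 * B / 8))"
  \<comment> \<open>The conditions on \<open>load\<close> are independent of the order: where one
    fails, the event is empty. This leaves two tail events for each realised level and row.\<close>
  define lo where "lo = (\<lambda>(l, j). {\<sigma>. (1 - \<epsilon> / 2) * B \<le> load j (lower l) \<and>
    sample_load j (lower l) \<sigma> \<le> \<epsilon> * (1 - \<epsilon>) * B})"
  define up where "up = (\<lambda>(l, j). {\<sigma>. load j (upper l) \<le> (1 - 5 / 2 * \<epsilon>) * B \<and>
    \<epsilon> * (1 - 3 / 2 * \<epsilon>) * B \<le> sample_load j (upper l) \<sigma>})"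
  let ?I = "range level \<times> {..<m}"
  have fin: "finite ?I" using finite_levels by simp
  have lo: "?P (lo x) \<le> ?e" if x_in: "x \<in> ?I" for x
  proof -
    obtain l j where x: "x = (l, j)" "j < m" using x_in by blast
    show ?thesis
      using prob_sample_load_small[OF lower_subset x(2), of l]
      by (cases "(1 - \<epsilon> / 2) * B \<le> load j (lower l)") (auto simp: lo_def x(1))
  qed
  have up: "?P (up x) \<le> ?e" if x_in: "x \<in> ?I" for x
  proof -
    obtain l j where x: "x = (l, j)" "j < m" using x_in by blast
    show ?thesis
      using prob_sample_load_large[OF upper_subset x(2), of l]
      by (cases "load j (upper l) \<le> (1 - 5 / 2 * \<epsilon>) * B") (auto simp: up_def x(1))
  qed
  have "?P {\<sigma>. bad \<sigma>} = ?P (\<Union>x\<in>?I. lo x \<union> up x)"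
    by (rule arg_cong[of _ _ ?P]) (auto simp: bad_def lo_def up_def)
  also have "\<dots> \<le> (\<Sum>x\<in>?I. ?P (lo x \<union> up x))"
    using fin by (intro measure_pmf.finite_measure_subadditive_finite) auto
  also have "\<dots> \<le> (\<Sum>x\<in>?I. 2 * ?e)"
  proof (rule sum_mono)
    fix x assume x: "x \<in> ?I"
    have "?P (lo x \<union> up x) \<le> ?P (lo x) + ?P (up x)"
      by (intro measure_Un_le) auto
    then show "?P (lo x \<union> up x) \<le> 2 * ?e" using lo[OF x] up[OF x] by simp
  qed
  also have "\<dots> = 2 * real m * real (card (range level)) * ?e" by (simp add: card_cartesian_product)
  also have "\<dots> \<le> 2 * real m * real (card dirs * (N + 1) + 1) ^ m * ?e"
  proof (intro mult_right_mono mult_left_mono)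
    have "real (card (range level)) \<le> real ((card dirs * (N + 1) + 1) ^ m)"
      using card_levels of_nat_mono by blast
    then show "real (card (range level)) \<le> real (card dirs * (N + 1) + 1) ^ m" by simp
  qed auto
  finally show ?thesis .
qed

lemma load_slack: "real (card dirs) * (B / N) \<le> \<epsilon> / 2 * B"
proof -
  have "real (card dirs) * B \<le> \<epsilon> / 2 * N * B" using fine B_pos by (intro mult_right_mono) auto
  then show ?thesis using N_pos by (simp add: field_simps)
qed

lemma sample_load_mono:
  assumes \<sigma>: "\<sigma> permutes {..<n}" and "A \<subseteq> A'" and i: "i < m"
  shows "sample_load i A \<sigma> \<le> sample_load i A' \<sigma>"
  unfolding sample_load_def
proof (rule sum_mono)
  fix k assume "k \<in> {..<s}"
  then have "\<sigma> k < n" using permutes_in_image[OF \<sigma>, of k] sample_le by simp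
  then have "0 \<le> col (\<sigma> k) i" using col_bounds(1) i by blast
  then show "(if \<sigma> k \<in> A then col (\<sigma> k) i else 0) \<le> (if \<sigma> k \<in> A' then col (\<sigma> k) i else 0)"
    using assms(2) by auto
qed

text \<open>An overload would make \<open>lower\<close> nearly full in some row \<open>j\<close>
  although its sampled load is at most that of \<open>chosen p\<close>, which is a bad event. As
  \<open>j\<close> may differ from \<open>i\<close>, the bound \<open>fit\<close> is required in all
  rows. \<open>p\<close> may depend on the sample.\<close>

lemma load_chosen_le:
  assumes good: "\<not> bad \<sigma>" and \<sigma>: "\<sigma> permutes {..<n}" and i: "i < m"
    and fit: "\<And>i. i < m \<Longrightarrow> sample_load i (chosen p) \<sigma> \<le> \<epsilon> * (1 - \<epsilon>) * B"
  shows "load i (chosen p) \<le> B"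
proof (rule ccontr)
  assume "\<not> load i (chosen p) \<le> B"
  then obtain j where j: "j < m" "B - card dirs * (B / N) < load j (lower (level p))"
    using load_lower_ge[OF i, of p] by auto
  have "(1 - \<epsilon> / 2) * B \<le> load j (lower (level p))"
    using j(2) load_slack unfolding left_diff_distrib by simp
  moreover have "sample_load j (lower (level p)) \<sigma> \<le> sample_load j (chosen p) \<sigma>"
    using \<sigma> lower_chosen j(1) by (rule sample_load_mono)
  then have "sample_load j (lower (level p)) \<sigma> \<le> \<epsilon> * (1 - \<epsilon>) * B" using fit[OF j(1)] by simp
  ultimately show False using good j(1) unfolding bad_def by blast
qed

text \<open>Otherwise \<open>upper\<close> would have load at most (1 - 3 epsilon) B + epsilon B /
  2, while its sampled load is at least that of \<open>chosen p\<close>: a bad event.\<close>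

lemma load_chosen_ge:
  assumes good: "\<not> bad \<sigma>" and \<sigma>: "\<sigma> permutes {..<n}" and i: "i < m"
    and feasible: "\<And>i. i < m \<Longrightarrow> load i (chosen p) \<le> B"
    and full: "\<epsilon> * (1 - 3 / 2 * \<epsilon>) * B \<le> sample_load i (chosen p) \<sigma>"
  shows "(1 - 3 * \<epsilon>) * B \<le> load i (chosen p)"
proof (rule ccontr)
  assume *: "\<not> (1 - 3 * \<epsilon>) * B \<le> load i (chosen p)"
  have "load i (upper (level p)) \<le> load i (chosen p) + \<epsilon> / 2 * B"
    using load_upper_le[OF i feasible] load_slack by (smt (verit))
  then have "load i (upper (level p)) \<le> (1 - 5 / 2 * \<epsilon>) * B"
    using * by (simp add: algebra_simps)
  moreover have "sample_load i (chosen p) \<sigma> \<le> sample_load i (upper (level p)) \<sigma>"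
    using \<sigma> chosen_upper i by (rule sample_load_mono)
  ultimately show False using good i full unfolding bad_def by (meson order_trans rangeI)
qed

text \<open>Weak duality, with the surpluses of the chosen columns as remaining dual variables,
  bounds any value by V - U plus \<open>B\<close> times the sum of prices. Near tightness bounds (1
  - 3 epsilon) times the latter term by U, and U \<le> V absorbs the remaining 3 epsilon U.\<close>

lemma lp_value_le_chosen:
  assumes p: "\<And>i. i < m \<Longrightarrow> 0 \<le> p i"
    and tight: "\<And>i. i < m \<Longrightarrow> 0 < p i \<Longrightarrow> (1 - 3 * \<epsilon>) * B \<le> load i (chosen p)"
    and x: "lp_feasible m n B col x"
  shows "(1 - 3 * \<epsilon>) * lp_value n \<pi> x \<le> (\<Sum>t\<in>chosen p. \<pi> t)"
proof -
  define V where "V = (\<Sum>t\<in>chosen p. \<pi> t)"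
  define U where "U = (\<Sum>t\<in>chosen p. dot m p (col t))"
  have fin: "finite (chosen p)" using chosen_subset finite_subset by blast
  have U: "U = (\<Sum>i<m. p i * load i (chosen p))"
    unfolding U_def dot_def load_def sum_distrib_left by (rule sum.swap)
  have "lp_value n \<pi> x \<le> (\<Sum>t<n. (if t \<in> chosen p then \<pi> t - dot m p (col t) else 0) + dot m p (col t) * x t)"
    unfolding lp_value_def
  proof (rule sum_mono)
    fix t assume "t \<in> {..<n}"
    then have x: "0 \<le> x t" "x t \<le> 1" and t: "t < n" using x by (auto simp: lp_feasible_def)
    show "\<pi> t * x t \<le> (if t \<in> chosen p then \<pi> t - dot m p (col t) else 0) + dot m p (col t) * x t"
    proof (cases "t \<in> chosen p")
      case True
      then have "(\<pi> t - dot m p (col t)) * x t \<le> \<pi> t - dot m p (col t)"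
        using x by (intro mult_left_le) (auto simp: chosen_def)
      then show ?thesis using True by (simp add: algebra_simps)
    next
      case False
      then show ?thesis using x t by (simp add: chosen_def mult_right_mono)
    qed
  qed
  also have "\<dots> = V - U + (\<Sum>t<n. dot m p (col t) * x t)"
    using chosen_subset[of p] fin
    by (simp add: sum.distrib sum.If_cases Int_absorb1 V_def U_def sum_subtractf)
  also have "(\<Sum>t<n. dot m p (col t) * x t) = (\<Sum>i<m. p i * (\<Sum>t<n. col t i * x t))"
    unfolding dot_def sum_distrib_right sum_distrib_left
    by (subst sum.swap) (simp add: mult_ac)
  also have "V - U + \<dots> \<le> V - U + (\<Sum>i<m. p i * B)"
    using x p by (intro add_left_mono sum_mono mult_left_mono) (auto simp: lp_feasible_def)
  finally have 1: "lp_value n \<pi> x \<le> V - U + (\<Sum>i<m. p i * B)" .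
  have "(1 - 3 * \<epsilon>) * (\<Sum>i<m. p i * B) \<le> U"
    unfolding U sum_distrib_left
  proof (rule sum_mono)
    fix i assume "i \<in> {..<m}"
    then have "p i * ((1 - 3 * \<epsilon>) * B) \<le> p i * load i (chosen p)"
      using p[of i] tight[of i] by (cases "p i = 0") (auto intro: mult_left_mono)
    then show "(1 - 3 * \<epsilon>) * (p i * B) \<le> p i * load i (chosen p)" by (simp add: mult_ac)
  qed
  moreover have "U \<le> V" unfolding U_def V_def by (intro sum_mono) (auto simp: chosen_def)
  ultimately have 2: "(1 - 3 * \<epsilon>) * (\<Sum>i<m. p i * B) \<le> U" and 3: "3 * \<epsilon> * U \<le> 3 * \<epsilon> * V"
    using eps_pos by auto
  have "(1 - 3 * \<epsilon>) * lp_value n \<pi> x \<le> (1 - 3 * \<epsilon>) * (V - U + (\<Sum>i<m. p i * B))"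
    using 1 eps_small by (intro mult_left_mono) auto
  also have "\<dots> = (1 - 3 * \<epsilon>) * V - (1 - 3 * \<epsilon>) * U + (1 - 3 * \<epsilon>) * (\<Sum>i<m. p i * B)"
    by (simp only: distrib_left right_diff_distrib)
  also have "\<dots> \<le> V" using 2 3 by (simp add: algebra_simps)
  finally show ?thesis by (simp add: V_def)
qed

end

section \<open>Approximate complementary slackness by perturbing one price\<close>

section \<open>Optimal dual solutions\<close>

lemma finite_positive_bound:
  assumes "finite T" "\<And>t. t \<in> T \<Longrightarrow> 0 < f t"
  shows "\<exists>h>(0::real). \<forall>t\<in>T. h \<le> f t"
proof (intro exI conjI ballI)
  \<comment> \<open>The element 1 provides for empty \<open>T\<close>.\<close>
  show "0 < Min (insert 1 (f ` T))" using assms by simp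
  show "Min (insert 1 (f ` T)) \<le> f t" if "t \<in> T" for t using assms that by simp
qed

lemma dot_update:
  assumes "i < m"
  shows "dot m (p(i := p i + h)) v = dot m p v + h * v i"
proof -
  have "dot m (p(i := p i + h)) v = (\<Sum>j<m. p j * v j + (if j = i then h * v j else 0))"
    unfolding dot_def by (intro sum.cong) (auto simp: distrib_right)
  then show ?thesis using assms by (simp add: sum.distrib dot_def)
qed

lemma sum_update:
  fixes i m :: nat
  assumes "i < m"
  shows "(\<Sum>j<m. (p(i := p i + h)) j) = (\<Sum>j<m. p j) + (h :: real)"
  using dot_update[OF assms, of p h "\<lambda>_. 1"] by (simp add: dot_def del: fun_upd_apply)

text \<open>Raise price \<open>i\<close> by a small \<open>h\<close> and lower each positive-surplus
  \<open>\<alpha> t\<close> by \<open>h * a t i\<close>. This stays feasible and changes the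
  objective by \<open>h\<close> times (capacity minus load), so an excess load would contradict
  optimality.\<close>

lemma dual_optimal_load_le:
  assumes opt: "dual_optimal m B \<pi> a \<epsilon> ts (p, \<alpha>)" and i: "i < m"
    and a: "\<And>t. t \<in> set ts \<Longrightarrow> 0 \<le> a t i \<and> a t i \<le> 1"
  shows "(\<Sum>t | t \<in> set ts \<and> dot m p (a t) < \<pi> t. a t i) \<le> \<epsilon> * (1 - \<epsilon>) * B"
proof (rule ccontr)
  define T where "T = {t. t \<in> set ts \<and> dot m p (a t) < \<pi> t}"
  assume "\<not> ?thesis"
  then have gt: "\<epsilon> * (1 - \<epsilon>) * B < (\<Sum>t\<in>T. a t i)" by (simp add: T_def)
  have feas: "dual_feasible m \<pi> a ts (p, \<alpha>)"
    and least: "\<And>y. dual_feasible m \<pi> a ts y \<Longrightarrow>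
      dual_objective m B \<epsilon> ts (p, \<alpha>) \<le> dual_objective m B \<epsilon> ts y"
    using opt unfolding dual_optimal_def is_arg_min_def by (auto simp: not_less)
  have "0 < \<alpha> t" if "t \<in> T" for t
  proof -
    have "\<pi> t \<le> dot m p (a t) + \<alpha> t" "dot m p (a t) < \<pi> t"
      using that feas by (auto simp: T_def dual_feasible_def)
    then show ?thesis by linarith
  qed
  then obtain h where h: "0 < h" "\<And>t. t \<in> T \<Longrightarrow> h \<le> \<alpha> t"
    using finite_positive_bound[of T \<alpha>] by (auto simp: T_def)
  define \<alpha>' where "\<alpha>' t = \<alpha> t - (if t \<in> T then h * a t i else 0)" for t
  have ha: "h * a t i \<le> h" "0 \<le> h * a t i" if "t \<in> set ts" for t
    using a[OF that] h(1) by (auto simp: mult_left_le)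
  have "dual_feasible m \<pi> a ts (p(i := p i + h), \<alpha>')"
    unfolding dual_feasible_def case_prod_conv dot_update[OF i]
  proof (intro conjI allI impI ballI)
    fix j assume "j < m"
    then show "0 \<le> (p(i := p i + h)) j" using feas h(1) by (auto simp: dual_feasible_def)
  next
    fix t assume t: "t \<in> set ts"
    have "0 \<le> \<alpha> t" "\<pi> t \<le> dot m p (a t) + \<alpha> t" using feas t by (auto simp: dual_feasible_def)
    then show "0 \<le> \<alpha>' t" "dot m p (a t) + h * a t i + \<alpha>' t \<ge> \<pi> t"
      using ha[OF t] h(2)[of t] by (auto simp: \<alpha>'_def)
  qed
  from least[OF this]
  have "\<epsilon> * (1 - \<epsilon>) * B * (\<Sum>i<m. p i) + (\<Sum>t\<in>set ts. \<alpha> t)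
      \<le> \<epsilon> * (1 - \<epsilon>) * B * ((\<Sum>i<m. p i) + h) + (\<Sum>t\<in>set ts. \<alpha>' t)"
    by (simp add: dual_objective_def sum_update[OF i] del: fun_upd_apply)
  also have "(\<Sum>t\<in>set ts. \<alpha>' t) = (\<Sum>t\<in>set ts. \<alpha> t) - h * (\<Sum>t\<in>T. a t i)"
    unfolding \<alpha>'_def sum_subtractf
    by (simp add: sum.inter_filter[symmetric] T_def sum_distrib_left)
  finally have "h * (\<Sum>t\<in>T. a t i) \<le> h * (\<epsilon> * (1 - \<epsilon>) * B)"
    by (simp add: algebra_simps)
  then show False using h(1) gt by simp
qed

text \<open>Lower price \<open>i\<close> by \<open>h\<close> and raise \<open>\<alpha>\<close> to
  compensate. Tied columns must be compensated too, whereas columns priced strictly above their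
  reward have slack at least \<open>h\<close>. So the load including ties reaches the capacity, and
  at most \<open>m\<close> ties contribute at most 1 each.\<close>

lemma dual_optimal_load_ge:
  assumes opt: "dual_optimal m B \<pi> a \<epsilon> ts (p, \<alpha>)" and i: "i < m" "0 < p i"
    and a: "\<And>t. t \<in> set ts \<Longrightarrow> 0 \<le> a t i \<and> a t i \<le> 1"
    and gen: "general_position m n \<pi> a" and ts: "set ts \<subseteq> {..<n}"
  shows "\<epsilon> * (1 - \<epsilon>) * B - m \<le> (\<Sum>t | t \<in> set ts \<and> dot m p (a t) < \<pi> t. a t i)"
proof (rule ccontr)
  define T where "T = {t. t \<in> set ts \<and> dot m p (a t) \<le> \<pi> t}"
  define S where "S = {t. t \<in> set ts \<and> dot m p (a t) < \<pi> t}"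
  assume "\<not> ?thesis"
  then have lt: "(\<Sum>t\<in>S. a t i) + m < \<epsilon> * (1 - \<epsilon>) * B" by (simp add: S_def)
  have "(\<Sum>t\<in>T. a t i) = (\<Sum>t\<in>S. a t i) + (\<Sum>t\<in>T-S. a t i)"
    by (subst sum.subset_diff[of S T]) (auto simp: S_def T_def)
  also have "(\<Sum>t\<in>T-S. a t i) \<le> (\<Sum>t\<in>T-S. 1)"
    using a by (intro sum_mono) (auto simp: T_def)
  also have "(\<Sum>t\<in>T-S. 1) = real (card (T - S))" by simp
  also have "card (T - S) \<le> card {t. t < n \<and> \<pi> t = dot m p (a t)}"
    using ts by (intro card_mono) (auto simp: T_def S_def)
  also have "\<dots> \<le> m" using gen by (simp add: general_position_def)
  finally have T: "(\<Sum>t\<in>T. a t i) < \<epsilon> * (1 - \<epsilon>) * B" using lt by simp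
  have feas: "dual_feasible m \<pi> a ts (p, \<alpha>)"
    and least: "\<And>y. dual_feasible m \<pi> a ts y \<Longrightarrow>
      dual_objective m B \<epsilon> ts (p, \<alpha>) \<le> dual_objective m B \<epsilon> ts y"
    using opt unfolding dual_optimal_def is_arg_min_def by (auto simp: not_less)
  obtain h where h: "0 < h" "\<And>t. t \<in> set ts - T \<Longrightarrow> h \<le> dot m p (a t) - \<pi> t" "h \<le> p i"
  proof -
    have "\<exists>h>0. \<forall>t\<in>set ts - T. h \<le> dot m p (a t) - \<pi> t"
      by (intro finite_positive_bound) (auto simp: T_def)
    then obtain h where "0 < h" "\<And>t. t \<in> set ts - T \<Longrightarrow> h \<le> dot m p (a t) - \<pi> t" by blast
    then show ?thesis using i(2) by (intro that[of "min h (p i)"]) (auto simp: min.coboundedI1)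
  qed
  define \<alpha>' where "\<alpha>' t = \<alpha> t + (if t \<in> T then h * a t i else 0)" for t
  have ha: "h * a t i \<le> h" "0 \<le> h * a t i" if "t \<in> set ts" for t
    using a[OF that] h(1) by (auto simp: mult_left_le)
  have "dual_feasible m \<pi> a ts (p(i := p i + - h), \<alpha>')"
    unfolding dual_feasible_def case_prod_conv dot_update[OF i(1)]
  proof (intro conjI allI impI ballI)
    fix j assume "j < m"
    then show "0 \<le> (p(i := p i + - h)) j" using feas h(3) by (auto simp: dual_feasible_def)
  next
    fix t assume t: "t \<in> set ts"
    have "0 \<le> \<alpha> t" "\<pi> t \<le> dot m p (a t) + \<alpha> t" using feas t by (auto simp: dual_feasible_def)
    then show "0 \<le> \<alpha>' t" "dot m p (a t) + - h * a t i + \<alpha>' t \<ge> \<pi> t"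
      using ha[OF t] h(2)[of t] t by (auto simp: \<alpha>'_def)
  qed
  from least[OF this]
  have "\<epsilon> * (1 - \<epsilon>) * B * (\<Sum>i<m. p i) + (\<Sum>t\<in>set ts. \<alpha> t)
      \<le> \<epsilon> * (1 - \<epsilon>) * B * ((\<Sum>i<m. p i) + - h) + (\<Sum>t\<in>set ts. \<alpha>' t)"
    unfolding dual_objective_def case_prod_conv sum_update[OF i(1)] .
  also have "(\<Sum>t\<in>set ts. \<alpha>' t) = (\<Sum>t\<in>set ts. \<alpha> t) + h * (\<Sum>t\<in>T. a t i)"
    unfolding \<alpha>'_def sum.distrib
    by (simp add: sum.inter_filter[symmetric] T_def sum_distrib_left)
  finally have "h * (\<epsilon> * (1 - \<epsilon>) * B) \<le> h * (\<Sum>t\<in>T. a t i)"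
    by (simp add: algebra_simps)
  then show False using h(1) T by simp
qed

section \<open>Feasibility of runs and basic facts on the LP optimum\<close>

section \<open>Runs of the algorithm\<close>

lemma otp_step_invariant:
  assumes "lp_feasible m n B a x" "\<forall>t. 0 \<le> x t" "\<And>t. 0 \<le> y t"
  shows "lp_feasible m n B a (fst (foldl (otp_step m n B a y) (x, b) ts)) \<and>
    (\<forall>t. 0 \<le> fst (foldl (otp_step m n B a y) (x, b) ts) t)"
  using assms(1,2)
proof (induction ts arbitrary: x b)
  case Nil
  then show ?case by simp
next
  case (Cons t ts)
  obtain x' b' where eq: "otp_step m n B a y (x, b) t = (x', b')" by fastforce
  then have "lp_feasible m n B a x'" "\<forall>t. 0 \<le> x' t"
    using Cons.prems assms(3) by (auto simp: otp_step_def split: if_splits)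
  from Cons.IH[OF this, of b'] show ?case by (simp add: eq)
qed

text \<open>Each update is guarded by the feasibility test, so this holds for every order and every
  rule \<open>sel\<close>, not only on good samples.\<close>

lemma otp_feasible: "lp_feasible m n B a (otp m n B \<pi> a \<epsilon> sel \<sigma>)"
  and otp_nonneg: "0 \<le> otp m n B \<pi> a \<epsilon> sel \<sigma> t"
  if "0 \<le> B"
  using otp_step_invariant[of m n B a "\<lambda>_. 0" "price_sol m \<pi> a (fst (sel (sampled \<epsilon> n \<sigma>)))" True
      "map \<sigma> [sample_size \<epsilon> n..<n]"] that
  by (auto simp: otp_def Let_def lp_feasible_def price_sol_def)

lemma lp_feasible_mono:
  assumes "lp_feasible m n B a y" and "\<And>t i. t < n \<Longrightarrow> i < m \<Longrightarrow> 0 \<le> a t i"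
    and "\<And>t. t < n \<Longrightarrow> 0 \<le> x t \<and> x t \<le> y t"
  shows "lp_feasible m n B a x"
proof -
  have "(\<Sum>t<n. a t i * x t) \<le> (\<Sum>t<n. a t i * y t)" if "i < m" for i
    using assms that by (intro sum_mono mult_left_mono) auto
  then show ?thesis using assms by (fastforce simp: lp_feasible_def)
qed

text \<open>All partial solutions lie below the feasible \<open>y\<close> and columns are
  nonnegative, so the test never fails.\<close>

lemma foldl_otp_step:
  assumes y: "lp_feasible m n B a y" and a: "\<And>t i. t < n \<Longrightarrow> i < m \<Longrightarrow> 0 \<le> a t i"
    and x: "\<And>t. x t = 0 \<or> x t = y t"
  shows "foldl (otp_step m n B a y) (x, True) ts = ((\<lambda>t. if t \<in> set ts then y t else x t), True)"
  using x
proof (induction ts arbitrary: x)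
  case Nil
  then show ?case by simp
next
  case (Cons t ts)
  have "lp_feasible m n B a (x(t := y t))"
  proof (rule lp_feasible_mono[OF y a])
    fix u assume "u < n"
    then have "0 \<le> y u" using y by (simp add: lp_feasible_def)
    then show "0 \<le> (x(t := y t)) u \<and> (x(t := y t)) u \<le> y u" using Cons.prems[of u] by auto
  qed
  then have "otp_step m n B a y (x, True) t = (x(t := y t), True)" by (simp add: otp_step_def)
  moreover have "foldl (otp_step m n B a y) (x(t := y t), True) ts
      = ((\<lambda>u. if u \<in> set ts then y u else (x(t := y t)) u), True)"
    using Cons.prems by (intro Cons.IH) auto
  ultimately show ?case by (auto simp: fun_eq_iff)
qed

text \<open>The supremum in \<open>lp_opt\<close> bounds every feasible value only once boundedness
  is known.\<close>

lemma bdd_above_lp_values: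
  "bdd_above (lp_value n \<pi> ` {x. lp_feasible m n B a x})"
proof (rule bdd_aboveI2)
  fix x assume "x \<in> {x. lp_feasible m n B a x}"
  then have x: "0 \<le> x t" "x t \<le> 1" if "t < n" for t using that by (auto simp: lp_feasible_def)
  have "\<pi> t * x t \<le> \<bar>\<pi> t\<bar>" if "t < n" for t
  proof -
    have "\<pi> t * x t \<le> \<bar>\<pi> t\<bar> * x t" using x[OF that] by (intro mult_right_mono) auto
    also have "\<dots> \<le> \<bar>\<pi> t\<bar>" using x[OF that] by (intro mult_left_le) auto
    finally show ?thesis .
  qed
  then show "lp_value n \<pi> x \<le> (\<Sum>t<n. \<bar>\<pi> t\<bar>)" unfolding lp_value_def by (intro sum_mono) simp
qed

lemma lp_value_le_opt:
  assumes "lp_feasible m n B a x"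
  shows "lp_value n \<pi> x \<le> lp_opt m n B \<pi> a"
  unfolding lp_opt_def using assms by (intro cSUP_upper bdd_above_lp_values) simp

lemma lp_opt_le:
  assumes "0 \<le> B" "\<And>x. lp_feasible m n B a x \<Longrightarrow> lp_value n \<pi> x \<le> v"
  shows "lp_opt m n B \<pi> a \<le> v"
  unfolding lp_opt_def
proof (rule cSUP_least)
  have "lp_feasible m n B a (\<lambda>_. 0)" using assms(1) by (simp add: lp_feasible_def)
  then show "{x. lp_feasible m n B a x} \<noteq> {}" by blast
qed (use assms(2) in simp)

lemma lp_opt_nonneg: "0 \<le> B \<Longrightarrow> 0 \<le> lp_opt m n B \<pi> a"
  using lp_value_le_opt[of m n B a "\<lambda>_. 0" \<pi>] by (simp add: lp_feasible_def lp_value_def)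

text \<open>The probability is the same for all positions by exchangeability, and over the
  \<open>n\<close> positions it sums to 1.\<close>

lemma expectation_position:
  assumes "t < n" "k < n"
  shows "measure_pmf.expectation (random_order n) (\<lambda>\<sigma>. if \<sigma> k = t then 1 else 0 :: real) = 1 / n"
proof -
  let ?e = "\<lambda>k. measure_pmf.expectation (random_order n) (\<lambda>\<sigma>. if \<sigma> k = t then 1 else 0 :: real)"
  have eq: "?e j = ?e k" if "j < n" for j
    using expectation_random_order_swap[OF that assms(2), of "\<lambda>\<sigma>. if \<sigma> k = t then 1 else 0"] by simp
  have "real n * ?e k = (\<Sum>j<n. ?e j)" using eq by simp
  also have "\<dots> = measure_pmf.expectation (random_order n) (\<lambda>\<sigma>. \<Sum>j<n. if \<sigma> j = t then 1 else 0 :: real)"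
    by (simp add: expectation_random_order_sum)
  also have "\<dots> = measure_pmf.expectation (random_order n) (\<lambda>\<sigma>. 1)"
  proof (rule expectation_random_order_cong)
    fix \<sigma> assume \<sigma>: "\<sigma> permutes {..<n}"
    have "(\<Sum>j<n. if \<sigma> j = t then 1 else 0 :: real) = (\<Sum>j<n. if j = t then 1 else 0)"
      using sum.permute[OF \<sigma>, of "\<lambda>j. if j = t then 1 else 0 :: real"] by (simp add: comp_def)
    then show "(\<Sum>j<n. if \<sigma> j = t then 1 else 0 :: real) = 1" using assms(1) by simp
  qed
  finally have "real n * ?e k = 1" by simp
  then show ?thesis using assms by (simp add: field_simps)
qed

section \<open>Combining sampling, duality and the run before rounding\<close>

section \<open>Expected value for few directions\<close>

context sampled_directional_lp
begin

lemma sample_size_eq: "sample_size \<epsilon> n = s"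
  unfolding sample_size_def sample[symmetric] by simp

lemma set_sampled: "set (sampled \<epsilon> n \<sigma>) = \<sigma> ` {..<s}"
  by (simp add: sampled_def sample_size_eq lessThan_atLeast0)

lemma sample_load_eq:
  assumes \<sigma>: "\<sigma> permutes {..<n}"
  shows "sample_load i (chosen p) \<sigma>
    = (\<Sum>t | t \<in> set (sampled \<epsilon> n \<sigma>) \<and> dot m p (col t) < \<pi> t. col t i)"
proof -
  have lt: "\<sigma> k < n" if "k < s" for k
    using permutes_in_image[OF \<sigma>, of k] sample_le that by simp
  have "(\<Sum>t | t \<in> set (sampled \<epsilon> n \<sigma>) \<and> dot m p (col t) < \<pi> t. col t i)
      = (\<Sum>t\<in>\<sigma> ` {..<s}. if dot m p (col t) < \<pi> t then col t i else 0)"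
    unfolding set_sampled by (simp add: sum.inter_filter[symmetric])
  also have "\<dots> = (\<Sum>k<s. if dot m p (col (\<sigma> k)) < \<pi> (\<sigma> k) then col (\<sigma> k) i else 0)"
    using permutes_inj_on[OF \<sigma>] by (subst sum.reindex) (auto simp: comp_def)
  also have "\<dots> = sample_load i (chosen p) \<sigma>"
    unfolding sample_load_def using lt by (intro sum.cong) (auto simp: chosen_def)
  finally show ?thesis by simp
qed

text \<open>Membership in the sample is written as a count of positions so that its expectation
  follows from \<open>expectation_position\<close> by linearity.\<close>

definition sample_part :: "(nat \<Rightarrow> real) \<Rightarrow> (nat \<Rightarrow> nat) \<Rightarrow> nat \<Rightarrow> real" where
  "sample_part p \<sigma> t = (if t \<in> chosen p then (\<Sum>k<s. if \<sigma> k = t then 1 else 0) else 0)"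

lemma sample_part_image:
  assumes \<sigma>: "\<sigma> permutes {..<n}" and "t < n"
  shows "(\<Sum>k<s. if \<sigma> k = t then 1 else 0 :: real) = (if t \<in> \<sigma> ` {..<s} then 1 else 0)"
proof -
  have "(\<Sum>k<s. if \<sigma> k = t then 1 else 0 :: real) = (\<Sum>u\<in>\<sigma> ` {..<s}. if u = t then 1 else 0)"
    using permutes_inj_on[OF \<sigma>] by (subst sum.reindex) (auto simp: comp_def)
  then show ?thesis by simp
qed

lemma sum_sample_part:
  assumes \<sigma>: "\<sigma> permutes {..<n}"
  shows "(\<Sum>t<n. col t i * sample_part p \<sigma> t) = sample_load i (chosen p) \<sigma>"
proof -
  have "(\<Sum>t<n. col t i * sample_part p \<sigma> t)
      = (\<Sum>t<n. \<Sum>k<s. if \<sigma> k = t then (if t \<in> chosen p then col t i else 0) else 0)"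
    unfolding sample_part_def by (intro sum.cong) (auto simp: sum_distrib_left intro!: sum.cong)
  also have "\<dots> = (\<Sum>k<s. \<Sum>t<n. if \<sigma> k = t then (if t \<in> chosen p then col t i else 0) else 0)"
    by (rule sum.swap)
  also have "\<dots> = sample_load i (chosen p) \<sigma>"
    unfolding sample_load_def using chosen_subset[of p] by (intro sum.cong) auto
  finally show ?thesis .
qed

text \<open>This bounds the value forgone by rejecting the sampled columns. The prices may depend on
  the order, since only the sampled loads are constrained.\<close>

lemma expectation_sample_part_le:
  assumes p: "\<And>\<sigma> i. \<sigma> permutes {..<n} \<Longrightarrow> i < m \<Longrightarrow> sample_load i (chosen (p \<sigma>)) \<sigma> \<le> \<epsilon> * (1 - \<epsilon>) * B"
  shows "measure_pmf.expectation (random_order n) (\<lambda>\<sigma>. lp_value n \<pi> (sample_part (p \<sigma>) \<sigma>))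
    \<le> \<epsilon> * lp_opt m n B \<pi> col"
proof -
  let ?E = "measure_pmf.expectation (random_order n) :: ((nat \<Rightarrow> nat) \<Rightarrow> real) \<Rightarrow> real"
  \<comment> \<open>Each index is sampled with probability \<open>\<epsilon>\<close> and every sample obeys the scaled capacities,
      so the averaged sample solution divided by \<open>\<epsilon>\<close> is feasible.\<close>
  define x where "x t = ?E (\<lambda>\<sigma>. sample_part (p \<sigma>) \<sigma> t) / \<epsilon>" for t
  have nonneg: "0 \<le> sample_part (p \<sigma>) \<sigma> t" for \<sigma> t
    by (simp add: sample_part_def sum_nonneg)
  have "lp_feasible m n B col x"
    unfolding lp_feasible_def
  proof (intro conjI allI impI)
    fix t assume t: "t < n"
    have "?E (\<lambda>\<sigma>. 0) \<le> ?E (\<lambda>\<sigma>. sample_part (p \<sigma>) \<sigma> t)"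
      by (intro expectation_random_order_mono nonneg)
    then show "0 \<le> x t" using eps_pos by (simp add: x_def)
    have "?E (\<lambda>\<sigma>. sample_part (p \<sigma>) \<sigma> t) \<le> ?E (\<lambda>\<sigma>. \<Sum>k<s. if \<sigma> k = t then 1 else 0)"
      by (intro expectation_random_order_mono) (simp add: sample_part_def sum_nonneg)
    also have "\<dots> = (\<Sum>k<s. 1 / n)"
      unfolding expectation_random_order_sum
      using sample_le t by (intro sum.cong expectation_position) auto
    also have "\<dots> = \<epsilon>" using sample n_pos by simp
    finally show "x t \<le> 1" using eps_pos by (simp add: x_def)
  next
    fix i assume i: "i < m"
    have "(\<Sum>t<n. col t i * x t) = ?E (\<lambda>\<sigma>. \<Sum>t<n. col t i * sample_part (p \<sigma>) \<sigma> t) / \<epsilon>"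
      by (simp add: x_def expectation_random_order_sum sum_divide_distrib)
    also have "?E (\<lambda>\<sigma>. \<Sum>t<n. col t i * sample_part (p \<sigma>) \<sigma> t) \<le> ?E (\<lambda>\<sigma>. \<epsilon> * (1 - \<epsilon>) * B)"
      by (intro expectation_random_order_mono) (simp add: sum_sample_part p i)
    also have "\<dots> = \<epsilon> * ((1 - \<epsilon>) * B)" by simp
    also have "\<dots> \<le> \<epsilon> * B" using eps_pos B_pos by (intro mult_left_mono) auto
    finally show "(\<Sum>t<n. col t i * x t) \<le> B" using eps_pos by (simp add: divide_right_mono)
  qed
  then have "lp_value n \<pi> x \<le> lp_opt m n B \<pi> col" by (rule lp_value_le_opt)
  moreover have "?E (\<lambda>\<sigma>. lp_value n \<pi> (sample_part (p \<sigma>) \<sigma>)) = \<epsilon> * lp_value n \<pi> x"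
    using eps_pos
    by (simp add: lp_value_def expectation_random_order_sum x_def sum_distrib_left)
  ultimately show ?thesis using eps_pos by simp
qed

text \<open>A feasible price solution is followed to the end, so the run collects every chosen
  column except those in the sample.\<close>

lemma lp_value_otp_good:
  assumes \<sigma>: "\<sigma> permutes {..<n}" and p: "p = fst (sel (sampled \<epsilon> n \<sigma>))"
    and load: "\<And>i. i < m \<Longrightarrow> load i (chosen p) \<le> B"
  shows "lp_value n \<pi> (otp m n B \<pi> col \<epsilon> sel \<sigma>)
    = (\<Sum>t\<in>chosen p. \<pi> t) - lp_value n \<pi> (sample_part p \<sigma>)"
proof -
  let ?y = "price_sol m \<pi> col p"
  have y: "?y t = (if t \<in> chosen p then 1 else 0)" if "t < n" for t
    using that by (simp add: price_sol_def chosen_def)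
  have "(\<Sum>t<n. col t i * ?y t) = load i (chosen p)" for i
  proof -
    have "(\<Sum>t<n. col t i * ?y t) = (\<Sum>t<n. if t \<in> chosen p then col t i else 0)"
      using y by (intro sum.cong) auto
    then show ?thesis
      using chosen_subset[of p] by (simp add: load_def sum.If_cases Int_absorb1)
  qed
  then have feas: "lp_feasible m n B col ?y"
    using load by (simp add: lp_feasible_def price_sol_def)
  have "otp m n B \<pi> col \<epsilon> sel \<sigma> = (\<lambda>t. if t \<in> \<sigma> ` {s..<n} then ?y t else 0)"
    using foldl_otp_step[OF feas col_bounds(1), of "\<lambda>_. 0" "map \<sigma> [s..<n]"]
    by (simp add: otp_def Let_def sample_size_eq p)
  then have "lp_value n \<pi> (otp m n B \<pi> col \<epsilon> sel \<sigma>) + lp_value n \<pi> (sample_part p \<sigma>)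
      = (\<Sum>t<n. \<pi> t * ((if t \<in> \<sigma> ` {s..<n} then ?y t else 0) + sample_part p \<sigma> t))"
    by (simp add: lp_value_def sum.distrib distrib_left)
  also have "\<dots> = (\<Sum>t<n. if t \<in> chosen p then \<pi> t else 0)"
  proof (intro sum.cong)
    fix t assume "t \<in> {..<n}"
    then have t: "t < n" by simp
    have "\<sigma> ` {..<n} = \<sigma> ` {..<s} \<union> \<sigma> ` {s..<n}"
      unfolding image_Un[symmetric] using ivl_disj_un_one(2)[of s n] sample_le by simp
    then have "t \<in> \<sigma> ` {..<s} \<union> \<sigma> ` {s..<n}"
      using permutes_image[OF \<sigma>] t by auto
    moreover have "t \<notin> \<sigma> ` {..<s} \<inter> \<sigma> ` {s..<n}"
      unfolding image_Int[OF permutes_inj[OF \<sigma>], symmetric] by auto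
    ultimately show "\<pi> t * ((if t \<in> \<sigma> ` {s..<n} then ?y t else 0) + sample_part p \<sigma> t)
        = (if t \<in> chosen p then \<pi> t else 0)"
      by (auto simp: y[OF t] sample_part_def sample_part_image[OF \<sigma> t])
  qed simp
  also have "\<dots> = (\<Sum>t\<in>chosen p. \<pi> t)"
    using chosen_subset[of p] by (simp add: sum.If_cases Int_absorb1)
  finally show ?thesis by simp
qed

text \<open>The loss is 3 epsilon for near tightness, epsilon for bad orders and epsilon for the
  sample. The assumption \<open>ties\<close> turns the deficit \<open>m\<close> of
  \<open>dual_optimal_load_ge\<close> into the threshold 1 - 3/2 epsilon used in
  \<open>bad\<close>.\<close>

theorem expectation_otp_ge:
  assumes gen: "general_position m n \<pi> col" and rule: "dual_rule m n B \<pi> col \<epsilon> sel"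
    and ties: "real m \<le> \<epsilon>\<^sup>2 * B / 2"
    and unlikely: "measure_pmf.prob (random_order n) {\<sigma>. bad \<sigma>} \<le> \<epsilon>"
  shows "(1 - 5 * \<epsilon>) * lp_opt m n B \<pi> col
    \<le> measure_pmf.expectation (random_order n) (\<lambda>\<sigma>. lp_value n \<pi> (otp m n B \<pi> col \<epsilon> sel \<sigma>))"
proof -
  let ?E = "measure_pmf.expectation (random_order n) :: ((nat \<Rightarrow> nat) \<Rightarrow> real) \<Rightarrow> real"
  define p where "p \<sigma> = fst (sel (sampled \<epsilon> n \<sigma>))" for \<sigma>
  define Opt where "Opt = lp_opt m n B \<pi> col"
  have Opt0: "0 \<le> Opt" unfolding Opt_def using B_pos by (intro lp_opt_nonneg) simp
  let ?alg = "\<lambda>\<sigma>. lp_value n \<pi> (otp m n B \<pi> col \<epsilon> sel \<sigma>)"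
  let ?part = "\<lambda>\<sigma>. lp_value n \<pi> (sample_part (p \<sigma>) \<sigma>)"
  have opt: "dual_optimal m B \<pi> col \<epsilon> (sampled \<epsilon> n \<sigma>) (p \<sigma>, snd (sel (sampled \<epsilon> n \<sigma>)))"
    if "\<sigma> permutes {..<n}" for \<sigma>
    using rule that unfolding dual_rule_def p_def by simp
  have sub: "set (sampled \<epsilon> n \<sigma>) \<subseteq> {..<n}" if \<sigma>: "\<sigma> permutes {..<n}" for \<sigma>
    unfolding set_sampled using permutes_image[OF \<sigma>] sample_le by auto
  have fit: "sample_load i (chosen (p \<sigma>)) \<sigma> \<le> \<epsilon> * (1 - \<epsilon>) * B"
    if \<sigma>: "\<sigma> permutes {..<n}" and i: "i < m" for \<sigma> i
    unfolding sample_load_eq[OF \<sigma>]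
    by (rule dual_optimal_load_le[OF opt[OF \<sigma>] i]) (use sub[OF \<sigma>] col_bounds i in blast)
  \<comment> \<open>For a bad order the left side is at most 0, so one inequality covers all orders
    and can be averaged.\<close>
  have pointwise: "(1 - 3 * \<epsilon>) * Opt * (1 - indicator {\<sigma>. bad \<sigma>} \<sigma>) - ?part \<sigma> \<le> ?alg \<sigma>"
    if \<sigma>: "\<sigma> permutes {..<n}" for \<sigma>
  proof (cases "bad \<sigma>")
    case True
    have "0 \<le> ?part \<sigma>"
      unfolding lp_value_def sample_part_def using profit by (intro sum_nonneg) (auto simp: sum_nonneg)
    moreover have "0 \<le> ?alg \<sigma>"
      unfolding lp_value_def using profit otp_nonneg B_pos by (intro sum_nonneg) auto
    ultimately show ?thesis using True by simp
  next
    case False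
    have load: "load i (chosen (p \<sigma>)) \<le> B" if "i < m" for i
      using load_chosen_le[OF False \<sigma> that] fit[OF \<sigma>] by blast
    have nonneg: "0 \<le> p \<sigma> i" if "i < m" for i
      using opt[OF \<sigma>] that unfolding dual_optimal_def is_arg_min_def dual_feasible_def by simp
    have tight: "(1 - 3 * \<epsilon>) * B \<le> load i (chosen (p \<sigma>))" if i: "i < m" and pos: "0 < p \<sigma> i" for i
    proof (rule load_chosen_ge[OF False \<sigma> i load])
      have "\<epsilon> * (1 - 3 / 2 * \<epsilon>) * B = \<epsilon> * (1 - \<epsilon>) * B - \<epsilon>\<^sup>2 * B / 2"
        by (simp add: field_simps power2_eq_square)
      also have "\<dots> \<le> \<epsilon> * (1 - \<epsilon>) * B - m" using ties by simp
      also have "\<dots> \<le> sample_load i (chosen (p \<sigma>)) \<sigma>"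
        unfolding sample_load_eq[OF \<sigma>]
        by (rule dual_optimal_load_ge[OF opt[OF \<sigma>] i pos _ gen sub[OF \<sigma>]])
          (use sub[OF \<sigma>] col_bounds i in blast)
      finally show "\<epsilon> * (1 - 3 / 2 * \<epsilon>) * B \<le> sample_load i (chosen (p \<sigma>)) \<sigma>" .
    qed
    have V: "(1 - 3 * \<epsilon>) * lp_value n \<pi> x \<le> (\<Sum>t\<in>chosen (p \<sigma>). \<pi> t)"
      if "lp_feasible m n B col x" for x
      by (rule lp_value_le_chosen[OF nonneg tight that])
    have "Opt \<le> (\<Sum>t\<in>chosen (p \<sigma>). \<pi> t) / (1 - 3 * \<epsilon>)"
      unfolding Opt_def using B_pos V eps_small
      by (intro lp_opt_le) (auto simp: pos_le_divide_eq mult.commute)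
    then have "(1 - 3 * \<epsilon>) * Opt \<le> (\<Sum>t\<in>chosen (p \<sigma>). \<pi> t)"
      using eps_small by (simp add: pos_le_divide_eq mult.commute)
    then show ?thesis using False lp_value_otp_good[of \<sigma> "p \<sigma>" sel, OF \<sigma> p_def load] by simp
  qed
  have "(1 - 5 * \<epsilon>) * Opt \<le> (1 - 3 * \<epsilon>) * Opt * (1 - \<epsilon>) - \<epsilon> * Opt"
    using Opt0 by (simp add: algebra_simps)
  also have "\<dots> \<le> (1 - 3 * \<epsilon>) * Opt * (1 - measure_pmf.prob (random_order n) {\<sigma>. bad \<sigma>}) - ?E ?part"
    using unlikely expectation_sample_part_le[OF fit] Opt0 eps_small
    unfolding Opt_def[symmetric] by (intro diff_mono mult_left_mono) auto
  also have "\<dots> = ?E (\<lambda>\<sigma>. (1 - 3 * \<epsilon>) * Opt * (1 - indicator {\<sigma>. bad \<sigma>} \<sigma>)) - ?E ?part"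
    using expectation_random_order_diff[of n "\<lambda>_. 1" "indicator {\<sigma>. bad \<sigma>}"] by simp
  also have "\<dots> = ?E (\<lambda>\<sigma>. (1 - 3 * \<epsilon>) * Opt * (1 - indicator {\<sigma>. bad \<sigma>} \<sigma>) - ?part \<sigma>)"
    by (rule expectation_random_order_diff[symmetric])
  also have "\<dots> \<le> ?E ?alg" by (rule expectation_random_order_mono) (rule pointwise)
  finally show ?thesis by (simp add: Opt_def)
qed

end

section \<open>The cost of grid rounding and the choice of constants\<close>

section \<open>Rounding the columns\<close>

lemma abs_le_linf: "i < m \<Longrightarrow> \<bar>v i\<bar> \<le> linf m v"
  by (auto simp: linf_def)

lemma linf_attained:
  assumes "0 < m"
  shows "\<exists>i<m. \<bar>v i\<bar> = linf m v"
proof -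
  have "linf m v \<in> (\<lambda>i. \<bar>v i\<bar>) ` {..<m}"
    unfolding linf_def using assms by (intro Max_in) auto
  then show ?thesis by auto
qed

lemma linf_le: "0 < m \<Longrightarrow> (\<And>i. i < m \<Longrightarrow> \<bar>v i\<bar> \<le> c) \<Longrightarrow> linf m v \<le> c"
  using linf_attained[of m v] by metis

lemma packing_linf:
  assumes "packing_lp m n B \<pi> a" "t < n"
  shows "0 < linf m (a t)" "linf m (a t) \<le> 1"
proof -
  have m: "0 < m" and a: "\<And>i. i < m \<Longrightarrow> 0 \<le> a t i \<and> a t i \<le> 1"
    using assms by (auto simp: packing_lp_def)
  obtain i where "i < m" "a t i \<noteq> 0" using assms by (auto simp: packing_lp_def)
  then show "0 < linf m (a t)" using abs_le_linf[of i m "a t"] by simp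
  show "linf m (a t) \<le> 1" using a by (intro linf_le[OF m]) simp
qed

text \<open>\<open>M\<close> is the reciprocal of the grid step, so an entry takes one of
  \<open>M + 1\<close> values.\<close>

lemma grid_entry:
  assumes q: "q \<in> grid m \<epsilon>" and i: "i < m" and M: "real M * \<epsilon> = real m + 1" and e: "0 < \<epsilon>"
  shows "q i \<in> (\<lambda>k. real k * (\<epsilon> / (real m + 1))) ` {..M}" "0 \<le> q i" "q i \<le> 1"
proof -
  obtain k where k: "real k * (\<epsilon> / (real m + 1)) \<le> 1" "q i = real k * (\<epsilon> / (real m + 1))"
    using q i by (auto simp: grid_def Let_def)
  have "real k * \<epsilon> \<le> real M * \<epsilon>" using k(1) M by (simp add: field_simps)
  then have "k \<le> M" using e by simp
  then show "q i \<in> (\<lambda>k. real k * (\<epsilon> / (real m + 1))) ` {..M}" using k(2) by blast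
  show "0 \<le> q i" "q i \<le> 1" using k e by auto
qed

lemma grid_one:
  assumes q: "q \<in> grid m \<epsilon>" and m: "0 < m" and e: "0 < \<epsilon>"
  shows "\<exists>i<m. q i = 1"
proof -
  have "linf m q = 1" using q by (simp add: grid_def Let_def)
  with linf_attained[OF m, of q] obtain i where i: "i < m" "\<bar>q i\<bar> = 1" by auto
  have "0 \<le> q i" using q i e by (auto simp: grid_def Let_def)
  then show ?thesis using i by auto
qed

text \<open>Round every coordinate down to a multiple of the step. A coordinate equal to 1 is kept
  because the step divides 1, so the norm remains 1.\<close>

lemma grid_near:
  assumes u: "\<And>i. i < m \<Longrightarrow> 0 \<le> u i \<and> u i \<le> 1" and one: "i1 < m" "u i1 = 1"
    and M: "real M * \<epsilon> = real m + 1" and e: "0 < \<epsilon>"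
  shows "\<exists>v\<in>grid m \<epsilon>. linf m (\<lambda>i. u i - v i) \<le> \<epsilon> / (real m + 1)"
proof -
  define \<delta> where "\<delta> = \<epsilon> / (real m + 1)"
  have d: "0 < \<delta>" using e by (simp add: \<delta>_def)
  have Md: "real M * \<delta> = 1" using M by (simp add: \<delta>_def)
  have m: "0 < m" using one by simp
  define k where "k i = nat \<lfloor>u i / \<delta>\<rfloor>" for i
  have k: "real (k i) \<le> u i / \<delta>" "u i / \<delta> < real (k i) + 1" if "i < m" for i
  proof -
    have "0 \<le> u i / \<delta>" using u[OF that] d by simp
    then show "real (k i) \<le> u i / \<delta>" "u i / \<delta> < real (k i) + 1" unfolding k_def by linarith+
  qed
  have kd: "real (k i) * \<delta> \<le> u i" "u i \<le> real (k i) * \<delta> + \<delta>" if "i < m" for i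
    using k[OF that] d by (auto simp: field_simps)
  have "1 / \<delta> = real M" using Md d by (simp add: field_simps)
  then have "k i1 = M" by (simp add: k_def one)
  have le1: "real (k i) * \<delta> \<le> 1" if "i < m" for i using kd(1)[OF that] u[OF that] by simp
  have "linf m (\<lambda>i. real (k i) * \<delta>) = 1"
  proof (rule antisym)
    show "linf m (\<lambda>i. real (k i) * \<delta>) \<le> 1" using le1 d by (intro linf_le[OF m]) simp
    show "1 \<le> linf m (\<lambda>i. real (k i) * \<delta>)"
      using abs_le_linf[OF one(1), of "\<lambda>i. real (k i) * \<delta>"] \<open>k i1 = M\<close> Md by simp
  qed
  then have "(\<lambda>i. real (k i) * \<delta>) \<in> grid m \<epsilon>"
    using le1 unfolding grid_def Let_def \<delta>_def[symmetric] by blast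
  moreover have "linf m (\<lambda>i. u i - real (k i) * \<delta>) \<le> \<delta>"
    using kd by (intro linf_le[OF m]) (auto simp: abs_le_iff diff_le_eq add.commute)
  ultimately show ?thesis
    unfolding \<delta>_def by (intro bexI[of _ "\<lambda>i. real (k i) * (\<epsilon> / (real m + 1))"])
qed

lemma rounded_near:
  assumes lp: "packing_lp m n B \<pi> a" and q: "closest_directions m n a \<epsilon> q"
    and M: "real M * \<epsilon> = real m + 1" and e: "0 < \<epsilon>" and t: "t < n" and i: "i < m"
  shows "\<bar>a t i - rounded m a q t i\<bar> \<le> \<epsilon> / (real m + 1) * linf m (a t)"
proof -
  define w where "w = linf m (a t)"
  have w: "0 < w" using packing_linf[OF lp t] by (simp add: w_def)
  have a: "0 \<le> a t i" if "i < m" for i using lp t that by (simp add: packing_lp_def)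
  define u where "u i = a t i / w" for i
  have u: "0 \<le> u i \<and> u i \<le> 1" if "i < m" for i
    using a[OF that] abs_le_linf[OF that, of "a t"] w by (simp add: u_def w_def)
  obtain i1 where i1: "i1 < m" "u i1 = 1"
    using linf_attained[of m "a t"] i a w by (auto simp: u_def w_def[symmetric])
  obtain v where v: "v \<in> grid m \<epsilon>" "linf m (\<lambda>i. u i - v i) \<le> \<epsilon> / (real m + 1)"
    using grid_near[of m u, OF u i1 M e] by blast
  have "is_arg_min (\<lambda>v. linf m (\<lambda>i. u i - v i)) (\<lambda>v. v \<in> grid m \<epsilon>) (q t)"
    using q t by (simp add: closest_directions_def u_def w_def)
  then have "linf m (\<lambda>i. u i - q t i) \<le> linf m (\<lambda>i. u i - v i)"
    using v(1) by (auto simp: is_arg_min_def not_less)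
  with v(2) abs_le_linf[OF i, of "\<lambda>i. u i - q t i"]
  have "\<bar>u i - q t i\<bar> \<le> \<epsilon> / (real m + 1)" by simp
  then have "\<bar>u i - q t i\<bar> * w \<le> \<epsilon> / (real m + 1) * w" using w by (intro mult_right_mono) auto
  also have "\<bar>u i - q t i\<bar> * w = \<bar>(u i - q t i) * w\<bar>" using w by (simp add: abs_mult)
  also have "(u i - q t i) * w = a t i - rounded m a q t i"
    using w by (simp add: u_def rounded_def w_def[symmetric] field_simps)
  finally show ?thesis by (simp add: w_def)
qed

text \<open>The error in a row is at most epsilon / (m + 1) times the total weight packed, which is
  at most the sum of all \<open>m\<close> loads. It is applied both from rounded to original columns
  and back.\<close>

lemma load_perturbed_le:
  fixes b c :: "nat \<Rightarrow> nat \<Rightarrow> real"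
  assumes x: "lp_feasible m n \<beta> b x" and i: "i < m" and e: "0 < \<epsilon>" and \<beta>: "0 \<le> \<beta>"
    and w: "\<And>t. t < n \<Longrightarrow> w t \<le> (\<Sum>j<m. b t j)"
    and c: "\<And>t. t < n \<Longrightarrow> c t i \<le> b t i + \<epsilon> / (real m + 1) * w t"
  shows "(\<Sum>t<n. c t i * x t) \<le> (1 + \<epsilon>) * \<beta>"
proof -
  have x0: "0 \<le> x t" if "t < n" for t using x that by (simp add: lp_feasible_def)
  have load: "(\<Sum>t<n. b t j * x t) \<le> \<beta>" if "j < m" for j using x that by (simp add: lp_feasible_def)
  have "(\<Sum>t<n. w t * x t) \<le> (\<Sum>t<n. (\<Sum>j<m. b t j) * x t)"
    using w x0 by (intro sum_mono mult_right_mono) auto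
  also have "\<dots> = (\<Sum>j<m. \<Sum>t<n. b t j * x t)"
    unfolding sum_distrib_right by (rule sum.swap)
  also have "\<dots> \<le> (\<Sum>j<m. \<beta>)" using load by (intro sum_mono) auto
  finally have W: "(\<Sum>t<n. w t * x t) \<le> m * \<beta>" by simp
  have "(\<Sum>t<n. c t i * x t) \<le> (\<Sum>t<n. (b t i + \<epsilon> / (real m + 1) * w t) * x t)"
    using c x0 by (intro sum_mono mult_right_mono) auto
  also have "\<dots> = (\<Sum>t<n. b t i * x t) + \<epsilon> / (real m + 1) * (\<Sum>t<n. w t * x t)"
    unfolding distrib_right sum.distrib sum_distrib_left mult.assoc ..
  also have "\<dots> \<le> \<beta> + \<epsilon> / (real m + 1) * (m * \<beta>)"
    using W e load[OF i] by (intro add_mono mult_left_mono) auto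
  also have "\<epsilon> / (real m + 1) * (m * \<beta>) \<le> \<epsilon> * \<beta>"
    using e \<beta> by (simp add: field_simps)
  finally show ?thesis by (simp add: algebra_simps)
qed

lemma closest_directions_grid:
  "closest_directions m n a \<epsilon> q \<Longrightarrow> t < n \<Longrightarrow> q t \<in> grid m \<epsilon>"
  by (simp add: closest_directions_def is_arg_min_def)

text \<open>The reduced capacity pays for the rounding error: (1 + epsilon) (1 - epsilon) \<le>
  1.\<close>

lemma rounded_feasible:
  assumes lp: "packing_lp m n B \<pi> a" and q: "closest_directions m n a \<epsilon> q"
    and M: "real M * \<epsilon> = real m + 1" and e: "0 < \<epsilon>" "\<epsilon> \<le> 1"
    and x: "lp_feasible m n ((1 - \<epsilon>) * B) (rounded m a q) x"
  shows "lp_feasible m n B a x"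
proof -
  have m: "0 < m" and B: "0 < B" using lp by (auto simp: packing_lp_def)
  have "(\<Sum>t<n. a t i * x t) \<le> B" if i: "i < m" for i
  proof -
    have "(\<Sum>t<n. a t i * x t) \<le> (1 + \<epsilon>) * ((1 - \<epsilon>) * B)"
    proof (rule load_perturbed_le[OF x i e(1), of "\<lambda>t. linf m (a t)"])
      fix t assume t: "t < n"
      note g = closest_directions_grid[OF q t]
      have w: "0 < linf m (a t)" using packing_linf[OF lp t] by simp
      obtain j where j: "j < m" "q t j = 1" using grid_one[OF g m e(1)] by blast
      have "rounded m a q t j \<le> (\<Sum>j<m. rounded m a q t j)"
        using w grid_entry(2)[OF g _ M e(1)] j(1)
        by (intro member_le_sum) (auto simp: rounded_def)
      then show "linf m (a t) \<le> (\<Sum>j<m. rounded m a q t j)" using j by (simp add: rounded_def)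
      show "a t i \<le> rounded m a q t i + \<epsilon> / (real m + 1) * linf m (a t)"
        using rounded_near[OF lp q M e(1) t i] by linarith
    qed (use B e in simp)
    also have "\<dots> = B - \<epsilon>\<^sup>2 * B" by (simp add: algebra_simps power2_eq_square)
    also have "\<dots> \<le> B" using B by simp
    finally show ?thesis .
  qed
  then show ?thesis using x by (simp add: lp_feasible_def)
qed

lemma rounded_opt_ge:
  assumes lp: "packing_lp m n B \<pi> a" and q: "closest_directions m n a \<epsilon> q"
    and M: "real M * \<epsilon> = real m + 1" and e: "0 < \<epsilon>" "\<epsilon> < 1"
  shows "(1 - 2 * \<epsilon>) * lp_opt m n B \<pi> a \<le> lp_opt m n ((1 - \<epsilon>) * B) \<pi> (rounded m a q)"
proof -
  have m: "0 < m" and B: "0 < B" using lp by (auto simp: packing_lp_def)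
  \<comment> \<open>Rounding inflates loads by at most 1 + epsilon, so scaling by \<open>c\<close>
    makes any solution fit the capacity (1 - epsilon) B.\<close>
  define c where "c = (1 - \<epsilon>) / (1 + \<epsilon>)"
  have c: "0 < c" "c \<le> 1" "1 - 2 * \<epsilon> \<le> c" "c * (1 + \<epsilon>) = 1 - \<epsilon>"
    using e by (auto simp: c_def field_simps)
  let ?O = "lp_opt m n ((1 - \<epsilon>) * B) \<pi> (rounded m a q)"
  have "lp_opt m n B \<pi> a \<le> ?O / c"
  proof (rule lp_opt_le)
    fix x assume x: "lp_feasible m n B a x"
    have "lp_feasible m n ((1 - \<epsilon>) * B) (rounded m a q) (\<lambda>t. c * x t)"
      unfolding lp_feasible_def
    proof (intro conjI allI impI)
      fix t assume "t < n"
      then have "0 \<le> x t" "x t \<le> 1" using x by (auto simp: lp_feasible_def)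
      then show "0 \<le> c * x t" "c * x t \<le> 1" using c by (auto intro: mult_le_one)
    next
      fix i assume i: "i < m"
      have "(\<Sum>t<n. rounded m a q t i * x t) \<le> (1 + \<epsilon>) * B"
      proof (rule load_perturbed_le[OF x i e(1), of "\<lambda>t. linf m (a t)"])
        fix t assume t: "t < n"
        obtain j where j: "j < m" "\<bar>a t j\<bar> = linf m (a t)" using linf_attained[OF m] by blast
        have a: "0 \<le> a t j" if "j < m" for j using lp t that by (simp add: packing_lp_def)
        have "a t j \<le> (\<Sum>j<m. a t j)" using a j(1) by (intro member_le_sum) auto
        then show "linf m (a t) \<le> (\<Sum>j<m. a t j)" using j a[OF j(1)] by simp
        show "rounded m a q t i \<le> a t i + \<epsilon> / (real m + 1) * linf m (a t)"
          using rounded_near[OF lp q M e(1) t i] by linarith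
      qed (use B in simp)
      then have "c * (\<Sum>t<n. rounded m a q t i * x t) \<le> c * ((1 + \<epsilon>) * B)"
        using c by (intro mult_left_mono) auto
      also have "c * ((1 + \<epsilon>) * B) = (1 - \<epsilon>) * B" using c(4) by (simp only: mult.assoc[symmetric])
      finally show "(\<Sum>t<n. rounded m a q t i * (c * x t)) \<le> (1 - \<epsilon>) * B"
        by (simp add: sum_distrib_left mult_ac)
    qed
    then have "lp_value n \<pi> (\<lambda>t. c * x t) \<le> ?O" by (rule lp_value_le_opt)
    moreover have "lp_value n \<pi> (\<lambda>t. c * x t) = c * lp_value n \<pi> x"
      by (simp add: lp_value_def sum_distrib_left mult_ac)
    ultimately show "lp_value n \<pi> x \<le> ?O / c" using c by (simp add: field_simps)
  qed (use B in simp)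
  then have "c * lp_opt m n B \<pi> a \<le> ?O" using c by (simp add: field_simps)
  moreover have "(1 - 2 * \<epsilon>) * lp_opt m n B \<pi> a \<le> c * lp_opt m n B \<pi> a"
    using c B by (intro mult_right_mono lp_opt_nonneg) auto
  ultimately show ?thesis by simp
qed

lemma (in directional_lp) card_dirs_le:
  assumes G: "finite G" and q: "\<And>t i. t < n \<Longrightarrow> i < m \<Longrightarrow> q t i \<in> G"
  shows "card dirs \<le> card G ^ m"
proof -
  let ?L = "{xs. set xs \<subseteq> G \<and> length xs = m}"
  have "dirs \<subseteq> (\<lambda>xs i. if i < m then xs ! i else 0) ` ?L"
  proof
    fix d assume "d \<in> dirs"
    then obtain t where t: "t < n" "d = dir t" by (auto simp: dirs_def)
    then have "d = (\<lambda>i. if i < m then map (q t) [0..<m] ! i else 0)"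
      by (auto simp: dir_def)
    moreover have "map (q t) [0..<m] \<in> ?L" using q t by auto
    ultimately show "d \<in> (\<lambda>xs i. if i < m then xs ! i else 0) ` ?L" by blast
  qed
  then have "card dirs \<le> card ?L"
    by (rule surj_card_le[OF finite_lists_length_eq[OF G]])
  then show ?thesis using G by (simp add: card_lists_length_eq)
qed

text \<open>All counts are powers of r = m / epsilon \<ge> 10: M + 1 is at most r^2, K at most
  r^(2m), and K (N + 1) + 1 at most r^(6m). The union bound divided by epsilon is thus at most r^(8
  m^2) exp(-epsilon^3 B / 8), for which 64 m^2 ln r \<le> epsilon^3 B suffices.\<close>

lemma union_bound_small:
  fixes m M K N :: nat and \<epsilon> B :: real
  assumes m: "0 < m" and e: "0 < \<epsilon>" "\<epsilon> < 1 / 10"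
    and M: "real M * \<epsilon> = real m + 1" and K: "0 < K" "K \<le> (M + 1) ^ m"
    and N: "real N \<le> 2 * real K / \<epsilon> + 1"
    and B: "72 * (real m)\<^sup>2 * ln (real m / \<epsilon>) \<le> \<epsilon> ^ 3 * B"
  shows "2 * real m * real (K * (N + 1) + 1) ^ m * exp (- (\<epsilon> ^ 3 * B / 8)) \<le> \<epsilon>"
    and "real m \<le> \<epsilon>\<^sup>2 * B / 2"
proof -
  define r where "r = real m / \<epsilon>"
  have m1: "1 \<le> real m" using m by simp
  have "10 * \<epsilon> \<le> real m" using m1 e by linarith
  then have r10: "10 \<le> r" using e by (simp add: r_def field_simps)
  have er: "1 / \<epsilon> \<le> r" using m1 e by (simp add: r_def divide_right_mono)
  have M': "real M = (real m + 1) / \<epsilon>" using M e by (simp add: field_simps)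
  have "real M + 1 = r + 1 / \<epsilon> + 1" using M' by (simp add: r_def add_divide_distrib)
  also have "\<dots> \<le> 3 * r" using er r10 by simp
  also have "\<dots> \<le> r ^ 2" using r10 by (simp add: power2_eq_square)
  finally have M1: "real M + 1 \<le> r ^ 2" .
  have "real K \<le> real ((M + 1) ^ m)" using K(2) of_nat_mono by blast
  also have "\<dots> = (real M + 1) ^ m" by (simp add: add.commute)
  also have "\<dots> \<le> (r ^ 2) ^ m" using M1 by (intro power_mono) auto
  finally have Kr: "real K \<le> r ^ (2 * m)" by (simp add: power_mult)
  have K1: "1 \<le> real K" using K(1) by simp
  have Kr10: "10 \<le> real K * r" using mult_mono[OF K1 r10] by simp
  have "2 * real K / \<epsilon> = 2 * real K * (1 / \<epsilon>)" by simp
  also have "\<dots> \<le> 2 * real K * r" using er by (intro mult_left_mono) auto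
  finally have N1: "real N + 1 \<le> 3 * (real K * r)" using N Kr10 by simp
  have KKr: "1 \<le> real K * (real K * r)" using mult_mono[OF K1, of 1 "real K * r"] Kr10 K1 by simp
  have "real (K * (N + 1) + 1) = real K * (real N + 1) + 1" by (simp add: distrib_left)
  also have "\<dots> \<le> real K * (3 * (real K * r)) + real K * (real K * r)"
    using N1 KKr by (intro add_mono mult_left_mono) auto
  also have "\<dots> = 4 * r * (real K)\<^sup>2" by (simp add: power2_eq_square)
  also have "\<dots> \<le> r\<^sup>2 * (r ^ (2 * m))\<^sup>2"
    using Kr r10 by (intro mult_mono power_mono) (auto simp: power2_eq_square)
  also have "\<dots> = r ^ (2 + 4 * m)" unfolding power_add power_mult[symmetric] by (simp add: mult.commute)
  also have "\<dots> \<le> r ^ (6 * m)" using r10 m by (intro power_increasing) auto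
  finally have H: "real (K * (N + 1) + 1) \<le> r ^ (6 * m)" .
  have "2 * r * real (K * (N + 1) + 1) ^ m \<le> r ^ 2 * (r ^ (6 * m)) ^ m"
    using H r10 by (intro mult_mono power_mono) (auto simp: power2_eq_square)
  also have "\<dots> = r ^ (2 + 6 * m * m)" unfolding power_add power_mult[symmetric] ..
  also have "\<dots> \<le> r ^ (8 * m * m)" using r10 m by (intro power_increasing) auto
  also have "\<dots> = exp (8 * (real m)\<^sup>2 * ln r)"
    using r10 by (simp add: exp_of_nat_mult[symmetric] powr_def flip: powr_realpow)
      (simp add: power2_eq_square mult_ac)
  also have "\<dots> \<le> exp (\<epsilon> ^ 3 * B / 8)"
  proof -
    have "0 \<le> (real m)\<^sup>2 * ln r" using r10 by simp
    then show ?thesis using B unfolding exp_le_cancel_iff r_def[symmetric] by linarith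
  qed
  finally have "2 * r * real (K * (N + 1) + 1) ^ m * exp (- (\<epsilon> ^ 3 * B / 8)) \<le> 1"
    by (simp add: exp_minus field_simps)
  then have "\<epsilon> * (2 * r * real (K * (N + 1) + 1) ^ m * exp (- (\<epsilon> ^ 3 * B / 8))) \<le> \<epsilon> * 1"
    using e by (intro mult_left_mono) auto
  moreover have "2 * real m * x * y = \<epsilon> * (2 * r * x * y)" for x y
    using e by (simp add: r_def)
  ultimately show "2 * real m * real (K * (N + 1) + 1) ^ m * exp (- (\<epsilon> ^ 3 * B / 8)) \<le> \<epsilon>"
    by (simp only: mult_1_right)
  have "exp 1 \<le> r" using r10 exp_le by linarith
  then have lr: "1 \<le> ln r" using r10 by (simp add: ln_ge_iff)
  have "72 * real m * \<epsilon> \<le> 72 * (real m)\<^sup>2 * ln r"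
  proof -
    have "real m * \<epsilon> \<le> real m * (real m * ln r)"
      using mult_mono[OF m1 lr] e by (intro mult_left_mono) auto
    then show ?thesis by (simp add: power2_eq_square mult_ac)
  qed
  also have "\<dots> \<le> \<epsilon> ^ 3 * B" using B by (simp add: r_def)
  also have "\<dots> = \<epsilon>\<^sup>2 * B * \<epsilon>" by (simp add: power2_eq_square power3_eq_cube)
  finally have "72 * real m \<le> \<epsilon>\<^sup>2 * B" using e by simp
  then show "real m \<le> \<epsilon>\<^sup>2 * B / 2" using m1 by linarith
qed

lemma integral_quotient:
  assumes "(real m + 1) / \<epsilon> \<in> \<int>" "0 < (\<epsilon> :: real)"
  shows "\<exists>M. real M * \<epsilon> = real m + 1"
proof -
  obtain k where k: "(real m + 1) / \<epsilon> = of_int k" using assms(1) by (auto elim: Ints_cases)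
  have "0 < (real m + 1) / \<epsilon>" using assms(2) by simp
  then have "real (nat k) = (real m + 1) / \<epsilon>" using k by simp
  then show ?thesis using assms(2) by (intro exI[of _ "nat k"]) simp
qed

lemma robust_otp_expectation:
  assumes lp: "packing_lp m n B \<pi> a" and e: "0 < \<epsilon>" "\<epsilon> < 1 / 10"
    and sample: "\<epsilon> * real n \<in> \<int>" and int: "(real m + 1) / \<epsilon> \<in> \<int>"
    and large: "B \<ge> 80 * ((real m)\<^sup>2 / \<epsilon> ^ 3) * ln (real m / \<epsilon>)"
    and q: "closest_directions m n a \<epsilon> q"
    and gen: "general_position m n \<pi> (rounded m a q)"
    and rule: "dual_rule m n ((1 - \<epsilon>) * B) \<pi> (rounded m a q) \<epsilon> sel"
  shows "(1 - 10 * \<epsilon>) * lp_opt m n B \<pi> a \<le> measure_pmf.expectation (random_order n)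
      (\<lambda>\<sigma>. lp_value n \<pi> (robust_otp m n B \<pi> a \<epsilon> q sel \<sigma>))"
proof -
  have m: "0 < m" and n: "0 < n" and B: "0 < B" and profit: "\<And>t. t < n \<Longrightarrow> 0 \<le> \<pi> t"
    using lp by (auto simp: packing_lp_def)
  obtain M where M: "real M * \<epsilon> = real m + 1" using integral_quotient[OF int e(1)] by blast
  obtain j where j: "\<epsilon> * real n = of_int j" using sample by (auto elim: Ints_cases)
  define s where "s = nat j"
  have "0 \<le> \<epsilon> * real n" using e by simp
  then have s: "real s = \<epsilon> * real n" using j by (simp add: s_def)
  define w where "w t = linf m (a t)" for t
  \<comment> \<open>This is \<open>card dirs\<close> spelled out, since \<open>N\<close> is chosen
    from it before the locale is interpreted.\<close>
  define K where "K = card ((\<lambda>t i. if i < m then q t i else 0) ` {..<n})"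
  define N where "N = nat \<lceil>2 * real K / \<epsilon>\<rceil>"
  have K0: "0 < K" using n by (simp add: K_def card_gt_0_iff lessThan_empty_iff)
  then have N0: "0 < 2 * real K / \<epsilon>" using e by simp
  then have N: "2 * real K / \<epsilon> \<le> real N" "real N \<le> 2 * real K / \<epsilon> + 1"
    unfolding N_def by linarith+
  define B' where "B' = (1 - \<epsilon>) * B"
  have B': "0 < B'" using B e by (simp add: B'_def)
  note g = closest_directions_grid[OF q]
  interpret L: directional_lp m n N B' \<pi> w q
  proof unfold_locales
    have "0 < real N" using N N0 by linarith
    then show "0 < N" by simp
    show "0 < w t \<and> w t \<le> 1" if "t < n" for t using packing_linf[OF lp that] by (simp add: w_def)
    show "0 \<le> q t i \<and> q t i \<le> 1" if "t < n" "i < m" for t i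
      using grid_entry(2,3)[OF g[OF that(1)] that(2) M e(1)] by simp
    show "\<exists>i<m. q t i = 1" if "t < n" for t using grid_one[OF g[OF that] m e(1)] .
  qed (fact n B')+
  have K: "card L.dirs = K" by (simp add: K_def L.dirs_def L.dir_def[abs_def])
  interpret L: sampled_directional_lp m n N B' \<pi> w q \<epsilon> s
  proof unfold_locales
    show "2 * real (card L.dirs) \<le> \<epsilon> * real N" using N(1) e by (simp add: K field_simps)
  qed (use e s profit in auto)
  have col: "L.col = rounded m a q" by (simp add: L.col_def w_def rounded_def fun_eq_iff)
  let ?G = "(\<lambda>k. real k * (\<epsilon> / (real m + 1))) ` {..M}"
  have "K \<le> card ?G ^ m"
    unfolding K[symmetric] using grid_entry(1)[OF g _ M e(1)] by (intro L.card_dirs_le) auto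
  also have "\<dots> \<le> (M + 1) ^ m" using card_image_le[of "{..M}"] by (intro power_mono) auto
  finally have KM: "K \<le> (M + 1) ^ m" .
  have "72 * (real m)\<^sup>2 * ln (real m / \<epsilon>) \<le> \<epsilon> ^ 3 * B'"
  proof -
    have "80 * ((real m)\<^sup>2 / \<epsilon> ^ 3) * ln (real m / \<epsilon>) * \<epsilon> ^ 3 \<le> B * \<epsilon> ^ 3"
      using large e by (intro mult_right_mono) auto
    then have "80 * (real m)\<^sup>2 * ln (real m / \<epsilon>) \<le> \<epsilon> ^ 3 * B"
      using e by (simp add: field_simps)
    moreover have "9 / 10 * (\<epsilon> ^ 3 * B) \<le> (1 - \<epsilon>) * (\<epsilon> ^ 3 * B)"
      using e B by (intro mult_right_mono) auto
    ultimately show ?thesis by (simp add: B'_def mult_ac)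
  qed
  note small = union_bound_small[OF m e M K0 KM N(2) this]
  have "(1 - 5 * \<epsilon>) * lp_opt m n B' \<pi> L.col \<le> measure_pmf.expectation (random_order n)
      (\<lambda>\<sigma>. lp_value n \<pi> (otp m n B' \<pi> L.col \<epsilon> sel \<sigma>))"
  proof (rule L.expectation_otp_ge)
    show "measure_pmf.prob (random_order n) {\<sigma>. L.bad \<sigma>} \<le> \<epsilon>"
      using L.prob_bad small(1) unfolding K by linarith
  qed (use gen rule small(2) in \<open>simp_all add: col B'_def\<close>)
  moreover have "(1 - 5 * \<epsilon>) * ((1 - 2 * \<epsilon>) * lp_opt m n B \<pi> a) \<le> (1 - 5 * \<epsilon>) * lp_opt m n B' \<pi> L.col"
    using rounded_opt_ge[OF lp q M e(1)] e by (intro mult_left_mono) (auto simp: col B'_def)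
  \<comment> \<open>The two losses combine to 1 - 7 epsilon + 10 epsilon^2.\<close>
  moreover have "(1 - 10 * \<epsilon>) * lp_opt m n B \<pi> a \<le> (1 - 5 * \<epsilon>) * ((1 - 2 * \<epsilon>) * lp_opt m n B \<pi> a)"
  proof -
    have "1 - 10 * \<epsilon> \<le> (1 - 5 * \<epsilon>) * (1 - 2 * \<epsilon>)" using e by (simp add: algebra_simps)
    then show ?thesis
      unfolding mult.assoc[symmetric] using B by (intro mult_right_mono lp_opt_nonneg) auto
  qed
  ultimately show ?thesis unfolding robust_otp_def col B'_def by linarith
qed

theorem theorem2:
  "\<exists>C>(0::real). \<forall>(m::nat) (n::nat) (B::real) (\<pi> :: nat \<Rightarrow> real) (a :: nat \<Rightarrow> nat \<Rightarrow> real) (\<epsilon>::real)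
      (q :: nat \<Rightarrow> nat \<Rightarrow> real) (sel :: nat list \<Rightarrow> (nat \<Rightarrow> real) \<times> (nat \<Rightarrow> real)).
     packing_lp m n B \<pi> a \<longrightarrow>
     0 < \<epsilon> \<longrightarrow> \<epsilon> \<le> 1 \<longrightarrow>
     \<epsilon> * real n \<in> \<int> \<longrightarrow> (real m + 1) / \<epsilon> \<in> \<int> \<longrightarrow>
     B \<ge> C * ((real m)\<^sup>2 / \<epsilon> ^ 3) * ln (real m / \<epsilon>) \<longrightarrow>
     closest_directions m n a \<epsilon> q \<longrightarrow>
     general_position m n \<pi> a \<longrightarrow>
     general_position m n \<pi> (rounded m a q) \<longrightarrow>
     dual_rule m n ((1 - \<epsilon>) * B) \<pi> (rounded m a q) \<epsilon> sel \<longrightarrow>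
       (\<forall>\<sigma>. \<sigma> permutes {..<n} \<longrightarrow> lp_feasible m n B a (robust_otp m n B \<pi> a \<epsilon> q sel \<sigma>)) \<and>
       measure_pmf.expectation (random_order n)
           (\<lambda>\<sigma>. lp_value n \<pi> (robust_otp m n B \<pi> a \<epsilon> q sel \<sigma>))
         \<ge> (1 - 10 * \<epsilon>) * lp_opt m n B \<pi> a"
\<comment> \<open>The bound with constant 72 must hold for the reduced capacity (1 - epsilon) B, at
  least 9/10 of \<open>B\<close> in the main case, and 72 = 80 * 9/10.\<close>
proof (rule exI[of _ 80], intro conjI allI impI)
  show "(0 :: real) < 80" by simp
next
  fix m n :: nat and B :: real and \<pi> :: "nat \<Rightarrow> real" and a :: "nat \<Rightarrow> nat \<Rightarrow> real" and \<epsilon> :: real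
    and q :: "nat \<Rightarrow> nat \<Rightarrow> real" and sel :: "nat list \<Rightarrow> (nat \<Rightarrow> real) \<times> (nat \<Rightarrow> real)"
    and \<sigma> :: "nat \<Rightarrow> nat"
  assume lp: "packing_lp m n B \<pi> a" and e: "0 < \<epsilon>" "\<epsilon> \<le> 1"
    and int: "(real m + 1) / \<epsilon> \<in> \<int>" and q: "closest_directions m n a \<epsilon> q"
  obtain M where M: "real M * \<epsilon> = real m + 1" using integral_quotient[OF int e(1)] by blast
  have "0 \<le> (1 - \<epsilon>) * B" using lp e by (simp add: packing_lp_def)
  then show "lp_feasible m n B a (robust_otp m n B \<pi> a \<epsilon> q sel \<sigma>)"
    unfolding robust_otp_def by (intro rounded_feasible[OF lp q M e] otp_feasible)
next
  fix m n :: nat and B :: real and \<pi> :: "nat \<Rightarrow> real" and a :: "nat \<Rightarrow> nat \<Rightarrow> real" and \<epsilon> :: real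
    and q :: "nat \<Rightarrow> nat \<Rightarrow> real" and sel :: "nat list \<Rightarrow> (nat \<Rightarrow> real) \<times> (nat \<Rightarrow> real)"
  assume lp: "packing_lp m n B \<pi> a" and e: "0 < \<epsilon>" "\<epsilon> \<le> 1"
    and sample: "\<epsilon> * real n \<in> \<int>" and int: "(real m + 1) / \<epsilon> \<in> \<int>"
    and large: "B \<ge> 80 * ((real m)\<^sup>2 / \<epsilon> ^ 3) * ln (real m / \<epsilon>)"
    and q: "closest_directions m n a \<epsilon> q"
    and gen: "general_position m n \<pi> (rounded m a q)"
    and rule: "dual_rule m n ((1 - \<epsilon>) * B) \<pi> (rounded m a q) \<epsilon> sel"
  have B: "0 < B" and profit: "\<And>t. t < n \<Longrightarrow> 0 \<le> \<pi> t" using lp by (auto simp: packing_lp_def)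
  show "(1 - 10 * \<epsilon>) * lp_opt m n B \<pi> a \<le> measure_pmf.expectation (random_order n)
      (\<lambda>\<sigma>. lp_value n \<pi> (robust_otp m n B \<pi> a \<epsilon> q sel \<sigma>))"
  proof (cases "\<epsilon> < 1 / 10")
    case True
    then show ?thesis
      using robust_otp_expectation[OF lp e(1) True sample int large q gen rule] by simp
  next
    case False
    have "(1 - 10 * \<epsilon>) * lp_opt m n B \<pi> a \<le> 0"
      using False lp_opt_nonneg[of B m n \<pi> a] B by (intro mult_nonpos_nonneg) auto
    also have "0 \<le> measure_pmf.expectation (random_order n)
        (\<lambda>\<sigma>. lp_value n \<pi> (robust_otp m n B \<pi> a \<epsilon> q sel \<sigma>))"
      unfolding lp_value_def robust_otp_def
      using B e profit by (intro Bochner_Integration.integral_nonneg sum_nonneg mult_nonneg_nonneg otp_nonneg) auto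
    finally show ?thesis .
  qed
qed

end
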